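(* Let $(X,\delta)$ be a $T_0$ injective approach space. Then $\Omega(X,\delta)$ is a cocomplete and continuous separated metric space, and $(X,\delta)=\Sigma\Omega(X,\delta)$.
   Context: Metric spaces. A metric space is a pair $(X,d)$ with $d:X\times X\to[0,\infty]$ such that $d(x,x)=0$ and $d(x,z)\le d(x,y)+d(y,z)$ for all $x,y,z$ (no symmetry or finiteness is required). It is separated if $d(x,y)=d(y,x)=0$ implies $x=y$. A map $f$ is non-expansive if $d_X(x,y)\ge d_Y(f(x),f(y))$. A non-expansive map $f:(X,d_X)\to(Y,d_Y)$ is left adjoint to a non-expansive map $g:(Y,d_Y)\to(X,d_X)$ if $d_Y(f(x),y)=d_X(x,g(y))$ for all $x\in X,y\in Y$. A net $\{x_i\}_i$ in $(X,d)$ is forward Cauchy if $\inf_i\sup_{k\ge j\ge i}d(x_j,x_k)=0$; $x$ is a Yoneda limit of it if $d(x,y)=\inf_i\sup_{j\ge i}d(x_j,y)$ for all $y\in X$. $(X,d)$ is Yoneda complete if every forward Cauchy net has a Yoneda limit. Weights. A weight of $(X,d)$ is $\phi:X\to[0,\infty]$ with $\phi(x)\le\phi(y)+d(x,y)$ for all $x,y$; a coweight is $\psi:X\to[0,\infty]$ with $\psi(y)\le\psi(x)+d(x,y)$. Write $\phi\otimes\psi=\inf_{x\in X}(\phi(x)+\psi(x))$. The set $\mathcal{P}X$ of weights carries the separated metric $\overline{d}(\phi,\psi)=\sup_{x\in X}\psi(x)\ominus\phi(x)$, where $a\ominus b=\max\{a-b,0\}$ with $\infty-\infty=0$ and $\infty-a=\infty$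 for $a<\infty$. The Yoneda embedding is $\mathbf{y}(x)=d(-,x)$. A weight $\phi$ is flat if $\inf_x\phi(x)=0$ and $\phi\otimes\max\{\psi_1,\psi_2\}=\max\{\phi\otimes\psi_1,\phi\otimes\psi_2\}$ for all coweights $\psi_1,\psi_2$; $\mathcal{F}X\subseteq\mathcal{P}X$ is the subspace of flat weights. An element $a\in X$ is a colimit of a weight $\phi$ if $\overline{d}(\phi,\mathbf{y}(y))=d(a,y)$ for all $y\in X$. $(X,d)$ is cocomplete if each weight has a colimit. In a Yoneda complete space every flat weight has a colimit, and $\operatorname{colim}:(\mathcal{F}X,\overline{d})\to(X,d)$ is left adjoint to $\mathbf{y}:(X,d)\to(\mathcal{F}X,\overline{d})$. $(X,d)$ is continuous if it is Yoneda complete and $\operatorname{colim}:(\mathcal{F}X,\overline{d})\to(X,d)$ has a left adjoint. Approach spaces. An approach space is a pair $(X,\delta)$ with $\delta:X\times 2^X\to[0,\infty]$ such that for all $x\in X$, $A,B\subseteq X$: $\delta(x,\{x\})=0$; $\delta(x,\varnothing)=\infty$; $\delta(x,A\cup B)=\min\{\delta(x,A),\delta(x,B)\}$; $\delta(x,A)\le\delta(x,B)+\sup_{b\in B}\delta(b,A)$. A contraction is a map with $\delta_X(x,A)\ge\delta_Y(f(x),f(A))$ for all $x,A$; a contraction $e$ is an embedding if $\delta_X(x,A)=\delta_Y(e(x),e(A))$ for all $x\in X,A\subseteq X$. $(X,\delta)$ is $T_0$ if $\delta(x,\{y\})=\delta(y,\{x\})=0$ implies $x=y$. A $T_0$ approach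 space $Z$ is injective if for every embedding $e:X\to Y$ of approach spaces and every contraction $f:X\to Z$ there is a contraction $f^*:Y\to Z$ with $f^*\circ e=f$. Functors. $\Omega(X,\delta)$ is the metric space on $X$ with metric $(x,y)\mapsto\delta(x,\{y\})$. A weight $\phi$ of a metric space $(X,d)$ is a Scott weight if $\inf_i\sup_{j\ge i}\phi(x_j)\ge\phi(x)$ for every forward Cauchy net $\{x_i\}_i$ and every Yoneda limit $x$ of it. $\Sigma(X,d)$ is the approach space $(X,\sigma)$ with $\sigma(x,A)=\sup\{\phi(x)\mid\phi\text{ a Scott weight of }(X,d),\ \phi(a)=0\text{ for all }a\in A\}$ (the Scott distance). *)

theory Defs
  imports "HOL-Analysis.Analysis"
begin

section \<open>Metric spaces\<close>

text \<open>
  Neither symmetry nor finiteness nor separation is required of a metric; this is not the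
  notion of the class \<^class>\<open>metric_space\<close>. All structures live on a carrier set, and
  functions on a carrier are only considered up to their values there.
\<close>

definition gen_metric_space :: "'a set \<Rightarrow> ('a \<Rightarrow> 'a \<Rightarrow> ennreal) \<Rightarrow> bool" where
  "gen_metric_space X d \<longleftrightarrow>
     (\<forall>x\<in>X. d x x = 0) \<and> (\<forall>x\<in>X. \<forall>y\<in>X. \<forall>z\<in>X. d x z \<le> d x y + d y z)"

definition separated :: "'a set \<Rightarrow> ('a \<Rightarrow> 'a \<Rightarrow> ennreal) \<Rightarrow> bool" where
  "separated X d \<longleftrightarrow> (\<forall>x\<in>X. \<forall>y\<in>X. d x y = 0 \<and> d y x = 0 \<longrightarrow> x = y)"

definition non_expansive ::
  "'a set \<Rightarrow> ('a \<Rightarrow> 'a \<Rightarrow> ennreal) \<Rightarrow> 'b set \<Rightarrow> ('b \<Rightarrow> 'b \<Rightarrow> ennreal) \<Rightarrow> ('a \<Rightarrow> 'b) \<Rightarrow> bool" where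
  "non_expansive X dX Y dY f \<longleftrightarrow> f \<in> X \<rightarrow> Y \<and> (\<forall>x\<in>X. \<forall>y\<in>X. dX x y \<ge> dY (f x) (f y))"

definition left_adjoint ::
  "'a set \<Rightarrow> ('a \<Rightarrow> 'a \<Rightarrow> ennreal) \<Rightarrow> 'b set \<Rightarrow> ('b \<Rightarrow> 'b \<Rightarrow> ennreal) \<Rightarrow> ('a \<Rightarrow> 'b) \<Rightarrow> ('b \<Rightarrow> 'a) \<Rightarrow> bool"
  where
  "left_adjoint X dX Y dY f g \<longleftrightarrow>
     non_expansive X dX Y dY f \<and> non_expansive Y dY X dX g \<and>
     (\<forall>x\<in>X. \<forall>y\<in>Y. dY (f x) y = dX x (g y))"


section \<open>Nets and Yoneda limits\<close>

definition directed_preorder :: "'i set \<Rightarrow> ('i \<Rightarrow> 'i \<Rightarrow> bool) \<Rightarrow> bool" where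
  "directed_preorder I le \<longleftrightarrow>
     I \<noteq> {} \<and> (\<forall>i\<in>I. le i i) \<and>
     (\<forall>i\<in>I. \<forall>j\<in>I. \<forall>k\<in>I. le i j \<and> le j k \<longrightarrow> le i k) \<and>
     (\<forall>i\<in>I. \<forall>j\<in>I. \<exists>k\<in>I. le i k \<and> le j k)"

definition inf_sup :: "'i set \<Rightarrow> ('i \<Rightarrow> 'i \<Rightarrow> bool) \<Rightarrow> ('i \<Rightarrow> ennreal) \<Rightarrow> ennreal" where
  "inf_sup I le g = (INF i\<in>I. SUP j\<in>{j\<in>I. le i j}. g j)"

definition net_in :: "'a set \<Rightarrow> 'i set \<Rightarrow> ('i \<Rightarrow> 'i \<Rightarrow> bool) \<Rightarrow> ('i \<Rightarrow> 'a) \<Rightarrow> bool" where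
  "net_in X I le x \<longleftrightarrow> directed_preorder I le \<and> x \<in> I \<rightarrow> X"

definition forward_cauchy ::
  "('a \<Rightarrow> 'a \<Rightarrow> ennreal) \<Rightarrow> 'i set \<Rightarrow> ('i \<Rightarrow> 'i \<Rightarrow> bool) \<Rightarrow> ('i \<Rightarrow> 'a) \<Rightarrow> bool" where
  "forward_cauchy d I le x \<longleftrightarrow>
     (INF i\<in>I. SUP (j, k)\<in>{(j, k). j \<in> I \<and> k \<in> I \<and> le i j \<and> le j k}. d (x j) (x k)) = 0"

definition yoneda_limit ::
  "'a set \<Rightarrow> ('a \<Rightarrow> 'a \<Rightarrow> ennreal) \<Rightarrow> 'i set \<Rightarrow> ('i \<Rightarrow> 'i \<Rightarrow> bool) \<Rightarrow> ('i \<Rightarrow> 'a) \<Rightarrow> 'a \<Rightarrow> bool" where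
  "yoneda_limit X d I le x a \<longleftrightarrow>
     a \<in> X \<and> (\<forall>y\<in>X. d a y = inf_sup I le (\<lambda>j. d (x j) y))"

text \<open>
  A formula cannot quantify over the types of all index sets. Nets in a space on \<open>'a\<close> are
  therefore indexed by arbitrary directed preorders carried by subsets of \<open>'a \<times> ennreal\<close>.
  This loses nothing: \<open>yoneda_complete_any_index\<close> and \<open>scott_weight_any_index\<close> below show that
  the properties defined with these nets hold for nets indexed by any type.
\<close>

type_synonym 'a net_index = "'a \<times> ennreal"

definition yoneda_complete :: "'a set \<Rightarrow> ('a \<Rightarrow> 'a \<Rightarrow> ennreal) \<Rightarrow> bool" where
  "yoneda_complete X d \<longleftrightarrow>
     (\<forall>(I :: 'a net_index set) le x.
        net_in X I le x \<and> forward_cauchy d I le x \<longrightarrow> (\<exists>a. yoneda_limit X d I le x a))"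


section \<open>Weights\<close>

definition weight :: "'a set \<Rightarrow> ('a \<Rightarrow> 'a \<Rightarrow> ennreal) \<Rightarrow> ('a \<Rightarrow> ennreal) \<Rightarrow> bool" where
  "weight X d \<phi> \<longleftrightarrow> (\<forall>x\<in>X. \<forall>y\<in>X. \<phi> x \<le> \<phi> y + d x y)"

definition coweight :: "'a set \<Rightarrow> ('a \<Rightarrow> 'a \<Rightarrow> ennreal) \<Rightarrow> ('a \<Rightarrow> ennreal) \<Rightarrow> bool" where
  "coweight X d \<psi> \<longleftrightarrow> (\<forall>x\<in>X. \<forall>y\<in>X. \<psi> y \<le> \<psi> x + d x y)"

definition tensor :: "'a set \<Rightarrow> ('a \<Rightarrow> ennreal) \<Rightarrow> ('a \<Rightarrow> ennreal) \<Rightarrow> ennreal" where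
  "tensor X \<phi> \<psi> = (INF x\<in>X. \<phi> x + \<psi> x)"

text \<open>Library subtraction has \<open>\<infinity> - \<infinity> = \<infinity>\<close>, whereas here \<open>\<infinity> \<ominus> \<infinity> = 0\<close>.\<close>

definition ominus :: "ennreal \<Rightarrow> ennreal \<Rightarrow> ennreal" where
  "ominus a b = (if a \<le> b then 0 else a - b)"

definition weight_dist :: "'a set \<Rightarrow> ('a \<Rightarrow> ennreal) \<Rightarrow> ('a \<Rightarrow> ennreal) \<Rightarrow> ennreal" where
  "weight_dist X \<phi> \<psi> = (SUP x\<in>X. ominus (\<psi> x) (\<phi> x))"

text \<open>
  Elements of \<open>\<P>X\<close> and \<open>\<F>X\<close> are functions on \<open>X\<close>; membership in \<^const>\<open>extensional\<close> gives each
  of them a unique representative.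
\<close>

definition weights :: "'a set \<Rightarrow> ('a \<Rightarrow> 'a \<Rightarrow> ennreal) \<Rightarrow> ('a \<Rightarrow> ennreal) set" where
  "weights X d = {\<phi> \<in> extensional X. weight X d \<phi>}"

definition yoneda :: "'a set \<Rightarrow> ('a \<Rightarrow> 'a \<Rightarrow> ennreal) \<Rightarrow> 'a \<Rightarrow> ('a \<Rightarrow> ennreal)" where
  "yoneda X d x = (\<lambda>z\<in>X. d z x)"

definition flat :: "'a set \<Rightarrow> ('a \<Rightarrow> 'a \<Rightarrow> ennreal) \<Rightarrow> ('a \<Rightarrow> ennreal) \<Rightarrow> bool" where
  "flat X d \<phi> \<longleftrightarrow>
     weight X d \<phi> \<and> (INF x\<in>X. \<phi> x) = 0 \<and>
     (\<forall>\<psi>1 \<psi>2. coweight X d \<psi>1 \<and> coweight X d \<psi>2 \<longrightarrow>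
        tensor X \<phi> (\<lambda>x. max (\<psi>1 x) (\<psi>2 x)) = max (tensor X \<phi> \<psi>1) (tensor X \<phi> \<psi>2))"

definition flat_weights :: "'a set \<Rightarrow> ('a \<Rightarrow> 'a \<Rightarrow> ennreal) \<Rightarrow> ('a \<Rightarrow> ennreal) set" where
  "flat_weights X d = {\<phi> \<in> weights X d. flat X d \<phi>}"

definition is_colimit :: "'a set \<Rightarrow> ('a \<Rightarrow> 'a \<Rightarrow> ennreal) \<Rightarrow> ('a \<Rightarrow> ennreal) \<Rightarrow> 'a \<Rightarrow> bool" where
  "is_colimit X d \<phi> a \<longleftrightarrow> a \<in> X \<and> (\<forall>y\<in>X. weight_dist X \<phi> (yoneda X d y) = d a y)"

definition cocomplete :: "'a set \<Rightarrow> ('a \<Rightarrow> 'a \<Rightarrow> ennreal) \<Rightarrow> bool" where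
  "cocomplete X d \<longleftrightarrow> (\<forall>\<phi>\<in>weights X d. \<exists>a. is_colimit X d \<phi> a)"

text \<open>
  In a Yoneda complete space every flat weight has a colimit, so \<open>colim\<close> is a map
  \<open>\<F>X \<rightarrow> X\<close>. Colimits are unique up to distance \<open>0\<close> in both directions, hence unique in a
  separated space, and the choice made here does not affect adjointness.
\<close>

definition colim :: "'a set \<Rightarrow> ('a \<Rightarrow> 'a \<Rightarrow> ennreal) \<Rightarrow> ('a \<Rightarrow> ennreal) \<Rightarrow> 'a" where
  "colim X d \<phi> = (SOME a. is_colimit X d \<phi> a)"

definition continuous_space :: "'a set \<Rightarrow> ('a \<Rightarrow> 'a \<Rightarrow> ennreal) \<Rightarrow> bool" where
  "continuous_space X d \<longleftrightarrow>
     yoneda_complete X d \<and>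
     (\<exists>t. left_adjoint X d (flat_weights X d) (weight_dist X) t (colim X d))"


section \<open>Approach spaces\<close>

definition approach_space :: "'a set \<Rightarrow> ('a \<Rightarrow> 'a set \<Rightarrow> ennreal) \<Rightarrow> bool" where
  "approach_space X \<delta> \<longleftrightarrow>
     (\<forall>x\<in>X. \<delta> x {x} = 0) \<and> (\<forall>x\<in>X. \<delta> x {} = \<infinity>) \<and>
     (\<forall>x\<in>X. \<forall>A B. A \<subseteq> X \<and> B \<subseteq> X \<longrightarrow> \<delta> x (A \<union> B) = min (\<delta> x A) (\<delta> x B)) \<and>
     (\<forall>x\<in>X. \<forall>A B. A \<subseteq> X \<and> B \<subseteq> X \<longrightarrow> \<delta> x A \<le> \<delta> x B + (SUP b\<in>B. \<delta> b A))"

definition contraction ::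
  "'a set \<Rightarrow> ('a \<Rightarrow> 'a set \<Rightarrow> ennreal) \<Rightarrow> 'b set \<Rightarrow> ('b \<Rightarrow> 'b set \<Rightarrow> ennreal) \<Rightarrow> ('a \<Rightarrow> 'b) \<Rightarrow> bool"
  where
  "contraction X \<delta>X Y \<delta>Y f \<longleftrightarrow>
     f \<in> X \<rightarrow> Y \<and> (\<forall>x\<in>X. \<forall>A. A \<subseteq> X \<longrightarrow> \<delta>X x A \<ge> \<delta>Y (f x) (f ` A))"

definition approach_embedding ::
  "'a set \<Rightarrow> ('a \<Rightarrow> 'a set \<Rightarrow> ennreal) \<Rightarrow> 'b set \<Rightarrow> ('b \<Rightarrow> 'b set \<Rightarrow> ennreal) \<Rightarrow> ('a \<Rightarrow> 'b) \<Rightarrow> bool"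
  where
  "approach_embedding X \<delta>X Y \<delta>Y e \<longleftrightarrow>
     contraction X \<delta>X Y \<delta>Y e \<and> (\<forall>x\<in>X. \<forall>A. A \<subseteq> X \<longrightarrow> \<delta>X x A = \<delta>Y (e x) (e ` A))"

definition T0_approach :: "'a set \<Rightarrow> ('a \<Rightarrow> 'a set \<Rightarrow> ennreal) \<Rightarrow> bool" where
  "T0_approach X \<delta> \<longleftrightarrow> (\<forall>x\<in>X. \<forall>y\<in>X. \<delta> x {y} = 0 \<and> \<delta> y {x} = 0 \<longrightarrow> x = y)"

definition extends_along_embeddings ::
  "'u itself \<Rightarrow> 'v itself \<Rightarrow> 'a set \<Rightarrow> ('a \<Rightarrow> 'a set \<Rightarrow> ennreal) \<Rightarrow> bool" where
  "extends_along_embeddings _ _ Z \<delta> \<longleftrightarrow>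
     (\<forall>(X :: 'u set) \<delta>X (Y :: 'v set) \<delta>Y e f.
        approach_space X \<delta>X \<and> approach_space Y \<delta>Y \<and>
        approach_embedding X \<delta>X Y \<delta>Y e \<and> contraction X \<delta>X Z \<delta> f \<longrightarrow>
        (\<exists>g. contraction Y \<delta>Y Z \<delta> g \<and> (\<forall>x\<in>X. g (e x) = f x)))"

text \<open>
  A formula cannot quantify over the types of all test spaces. The test spaces here are all
  approach spaces carried by subsets of the power \<open>'a set \<Rightarrow> ennreal\<close>. This loses nothing:
  \<open>injective_approach_any_type\<close> below shows that the extension property then holds for test
  spaces on any types, because a $T_0$ space embeds into that power.
\<close>

definition injective_approach :: "'a set \<Rightarrow> ('a \<Rightarrow> 'a set \<Rightarrow> ennreal) \<Rightarrow> bool" where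
  "injective_approach Z \<delta> \<longleftrightarrow>
     approach_space Z \<delta> \<and> T0_approach Z \<delta> \<and>
     extends_along_embeddings TYPE('a set \<Rightarrow> ennreal) TYPE('a set \<Rightarrow> ennreal) Z \<delta>"


section \<open>The functors\<close>

definition Omega :: "('a \<Rightarrow> 'a set \<Rightarrow> ennreal) \<Rightarrow> 'a \<Rightarrow> 'a \<Rightarrow> ennreal" where
  "Omega \<delta> x y = \<delta> x {y}"

definition scott_weight :: "'a set \<Rightarrow> ('a \<Rightarrow> 'a \<Rightarrow> ennreal) \<Rightarrow> ('a \<Rightarrow> ennreal) \<Rightarrow> bool" where
  "scott_weight X d \<phi> \<longleftrightarrow>
     weight X d \<phi> \<and>
     (\<forall>(I :: 'a net_index set) le x a.
        net_in X I le x \<and> forward_cauchy d I le x \<and> yoneda_limit X d I le x a \<longrightarrow>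
        inf_sup I le (\<lambda>j. \<phi> (x j)) \<ge> \<phi> a)"

definition Sigma_dist :: "'a set \<Rightarrow> ('a \<Rightarrow> 'a \<Rightarrow> ennreal) \<Rightarrow> 'a \<Rightarrow> 'a set \<Rightarrow> ennreal" where
  "Sigma_dist X d x A = (SUP \<phi>\<in>{\<phi>. scott_weight X d \<phi> \<and> (\<forall>a\<in>A. \<phi> a = 0)}. \<phi> x)"

section \<open>Independence of the index type of nets\<close>

lemma inf_sup_mono:
  assumes "\<And>j. j \<in> I \<Longrightarrow> g j \<le> h j"
  shows "inf_sup I le g \<le> inf_sup I le h"
  unfolding inf_sup_def by (rule INF_superset_mono[OF order_refl], rule SUP_mono) (use assms in blast)

lemma inf_sup_add_le:
  assumes "directed_preorder I le"
  shows "inf_sup I le (\<lambda>j. g j + h j) \<le> inf_sup I le g + inf_sup I le h"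
proof (cases "inf_sup I le g = top \<or> inf_sup I le h = top")
  case False
  let ?S = "\<lambda>g i. SUP j\<in>{j\<in>I. le i j}. g j"
  show ?thesis
  proof (rule ennreal_le_epsilon)
    fix e :: real assume "0 < e"
    then have e: "0 < ennreal (e / 2)" by simp
    have "inf_sup I le g < inf_sup I le g + ennreal (e / 2)"
      "inf_sup I le h < inf_sup I le h + ennreal (e / 2)"
      using False e ennreal_add_left_cancel_less[of _ 0] by auto
    then obtain i k where i: "i \<in> I" "?S g i < inf_sup I le g + ennreal (e / 2)"
      and k: "k \<in> I" "?S h k < inf_sup I le h + ennreal (e / 2)"
      unfolding inf_sup_def INF_less_iff by blast
    obtain l where l: "l \<in> I" "le i l" "le k l"
      using assms i k unfolding directed_preorder_def by blast
    have "inf_sup I le (\<lambda>j. g j + h j) \<le> ?S (\<lambda>j. g j + h j) l"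
      unfolding inf_sup_def using l(1) by (rule INF_lower)
    also have "\<dots> \<le> ?S g i + ?S h k"
    proof (rule SUP_least)
      fix j assume "j \<in> {j \<in> I. le l j}"
      then have "j \<in> {j \<in> I. le i j}" "j \<in> {j \<in> I. le k j}"
        using assms i k l unfolding directed_preorder_def by blast+
      then show "g j + h j \<le> ?S g i + ?S h k" by (intro add_mono SUP_upper)
    qed
    also have "\<dots> \<le> (inf_sup I le g + ennreal (e / 2)) + (inf_sup I le h + ennreal (e / 2))"
      using i k by (intro add_mono) auto
    also have "\<dots> = inf_sup I le g + inf_sup I le h + (ennreal (e / 2) + ennreal (e / 2))"
      by (simp add: ac_simps)
    also have "ennreal (e / 2) + ennreal (e / 2) = ennreal e"
      using \<open>0 < e\<close> by (simp flip: ennreal_plus)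
    finally show "inf_sup I le (\<lambda>j. g j + h j) \<le> inf_sup I le g + inf_sup I le h + ennreal e" .
  qed
qed auto

lemma inf_sup_const:
  assumes "directed_preorder I le"
  shows "inf_sup I le (\<lambda>_. c) = c"
proof -
  have "(SUP j\<in>{j\<in>I. le i j}. c) = c" if "i \<in> I" for i
    using that assms unfolding directed_preorder_def by (intro SUP_const) blast
  then have "inf_sup I le (\<lambda>_. c) = (INF i\<in>I. c)"
    unfolding inf_sup_def by (intro INF_cong refl)
  also have "\<dots> = c"
    using assms unfolding directed_preorder_def by (intro INF_const) blast
  finally show ?thesis .
qed

lemma le_add_ominus: "a \<le> ominus a b + b"
  by (cases "a \<le> b") (simp_all add: ominus_def diff_add_cancel_ennreal)

lemma ominus_le: "a \<le> c + b \<Longrightarrow> ominus a b \<le> c"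
  by (cases "a \<le> b") (auto simp: ominus_def ennreal_minus_le_iff add.commute)

definition net_weight where
  "net_weight d I le x z = inf_sup I le (\<lambda>j. d z (x j))"

lemma forward_cauchyD:
  assumes "forward_cauchy d I le x" "0 < \<epsilon>"
  obtains i where "i \<in> I"
    "\<And>j k. j \<in> I \<Longrightarrow> k \<in> I \<Longrightarrow> le i j \<Longrightarrow> le j k \<Longrightarrow> d (x j) (x k) < \<epsilon>"
proof -
  have "(INF i\<in>I. SUP (j, k)\<in>{(j, k). j \<in> I \<and> k \<in> I \<and> le i j \<and> le j k}. d (x j) (x k)) < \<epsilon>"
    using assms unfolding forward_cauchy_def by simp
  then obtain i where i: "i \<in> I"
    "(SUP (j, k)\<in>{(j, k). j \<in> I \<and> k \<in> I \<and> le i j \<and> le j k}. d (x j) (x k)) < \<epsilon>"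
    unfolding INF_less_iff by blast
  show thesis
  proof (rule that[OF i(1)])
    fix j k assume "j \<in> I" "k \<in> I" "le i j" "le j k"
    then have "d (x j) (x k) \<le>
        (SUP (j, k)\<in>{(j, k). j \<in> I \<and> k \<in> I \<and> le i j \<and> le j k}. d (x j) (x k))"
      by (intro SUP_upper2[of "(j, k)"]) auto
    then show "d (x j) (x k) < \<epsilon>" using i(2) by (rule le_less_trans)
  qed
qed

lemma net_weight_small:
  assumes "directed_preorder I le" "forward_cauchy d I le x" "0 < \<epsilon>"
  obtains i where "i \<in> I" "\<And>j. j \<in> I \<Longrightarrow> le i j \<Longrightarrow> net_weight d I le x (x j) \<le> \<epsilon>"
proof -
  obtain i where i: "i \<in> I"
    "\<And>j k. j \<in> I \<Longrightarrow> k \<in> I \<Longrightarrow> le i j \<Longrightarrow> le j k \<Longrightarrow> d (x j) (x k) < \<epsilon>"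
    using forward_cauchyD[OF assms(2,3)] by blast
  have "net_weight d I le x (x j) \<le> \<epsilon>" if "j \<in> I" "le i j" for j
    unfolding net_weight_def inf_sup_def
    by (rule INF_lower2[OF that(1)], rule SUP_least) (use i that in \<open>auto intro: less_imp_le\<close>)
  then show thesis using i(1) that by blast
qed

lemma inf_sup_weight:
  assumes "net_in X I le x" "forward_cauchy d I le x" "weight X d \<phi>"
  shows "inf_sup I le (\<lambda>j. \<phi> (x j)) = weight_dist X (net_weight d I le x) \<phi>"
proof (rule antisym)
  let ?w = "net_weight d I le x" and ?L = "inf_sup I le (\<lambda>j. \<phi> (x j))"
  have dir: "directed_preorder I le" and xX: "\<And>j. j \<in> I \<Longrightarrow> x j \<in> X"
    using assms(1) unfolding net_in_def by auto
  show "weight_dist X ?w \<phi> \<le> ?L"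
    unfolding weight_dist_def
  proof (intro SUP_least ominus_le)
    fix z assume z: "z \<in> X"
    have "\<phi> z = inf_sup I le (\<lambda>_. \<phi> z)" by (simp add: inf_sup_const[OF dir])
    also have "\<dots> \<le> inf_sup I le (\<lambda>j. \<phi> (x j) + d z (x j))"
      by (rule inf_sup_mono) (use assms(3) z xX in \<open>auto simp: weight_def\<close>)
    also have "\<dots> \<le> ?L + ?w z"
      unfolding net_weight_def by (rule inf_sup_add_le[OF dir])
    finally show "\<phi> z \<le> ?L + ?w z" .
  qed
  show "?L \<le> weight_dist X ?w \<phi>"
  proof (rule ennreal_le_epsilon)
    fix e :: real assume "0 < e"
    then have e: "0 < ennreal e" by simp
    obtain i where i: "i \<in> I" "\<And>j. j \<in> I \<Longrightarrow> le i j \<Longrightarrow> ?w (x j) \<le> ennreal e"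
      using net_weight_small[OF dir assms(2) e] by blast
    show "?L \<le> weight_dist X ?w \<phi> + ennreal e"
      unfolding inf_sup_def
    proof (rule INF_lower2[OF i(1)], rule SUP_least)
      fix j assume j: "j \<in> {j \<in> I. le i j}"
      have "\<phi> (x j) \<le> ominus (\<phi> (x j)) (?w (x j)) + ?w (x j)" by (rule le_add_ominus)
      also have "\<dots> \<le> weight_dist X ?w \<phi> + ennreal e"
        unfolding weight_dist_def
        by (intro add_mono SUP_upper) (use j i xX in auto)
      finally show "\<phi> (x j) \<le> weight_dist X ?w \<phi> + ennreal e" .
    qed
  qed
qed

lemma net_weight_weight:
  assumes "gen_metric_space X d" "net_in X I le x"
  shows "weight X d (net_weight d I le x)"
  unfolding weight_def
proof (intro ballI)
  fix z y assume zy: "z \<in> X" "y \<in> X"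
  have dir: "directed_preorder I le" and xX: "\<And>j. j \<in> I \<Longrightarrow> x j \<in> X"
    using assms(2) unfolding net_in_def by auto
  have "net_weight d I le x z \<le> inf_sup I le (\<lambda>j. d y (x j) + d z y)"
    unfolding net_weight_def
    by (rule inf_sup_mono) (use assms(1) zy xX in \<open>auto simp: gen_metric_space_def add.commute\<close>)
  also have "\<dots> \<le> net_weight d I le x y + d z y"
    unfolding net_weight_def
    using inf_sup_add_le[OF dir, of "\<lambda>j. d y (x j)" "\<lambda>_. d z y"] by (simp add: inf_sup_const[OF dir])
  finally show "net_weight d I le x z \<le> net_weight d I le x y + d z y" .
qed

lemma net_reindex:
  fixes I :: "'i set" and X :: "'a set"
  assumes met: "gen_metric_space X d" and net: "net_in X I le x" and fc: "forward_cauchy d I le x"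
  obtains J :: "'a net_index set" and le' y where
    "net_in X J le' y" "forward_cauchy d J le' y"
    "\<And>\<phi>. weight X d \<phi> \<Longrightarrow> inf_sup J le' (\<lambda>j. \<phi> (y j)) = inf_sup I le (\<lambda>j. \<phi> (x j))"
proof -
  let ?w = "net_weight d I le x"
  define J where "J = {(z, r). z \<in> X \<and> ?w z < r}"
  define le' where "le' = (\<lambda>(z, r) (y, s :: ennreal). d z y + s \<le> r)"
  have dir: "directed_preorder I le" and xX: "\<And>j. j \<in> I \<Longrightarrow> x j \<in> X"
    using net unfolding net_in_def by auto
  have d0: "\<And>z. z \<in> X \<Longrightarrow> d z z = 0"
    and tri: "\<And>u v z. u \<in> X \<Longrightarrow> v \<in> X \<Longrightarrow> z \<in> X \<Longrightarrow> d u z \<le> d u v + d v z"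
    using met unfolding gen_metric_space_def by auto
  have w: "weight X d ?w" by (rule net_weight_weight[OF met net])
  have leD: "d (fst p) (fst q) \<le> snd p" "snd q \<le> snd p" if "le' p q" for p q
  proof -
    have *: "d (fst p) (fst q) + snd q \<le> snd p" using that by (simp add: le'_def case_prod_beta)
    show "d (fst p) (fst q) \<le> snd p" by (rule order_trans[OF _ *]) simp
    show "snd q \<le> snd p" by (rule order_trans[OF _ *]) simp
  qed
  \<comment> \<open>every element of the new index set is eventually below the elements of the net\<close>
  have ev: "\<exists>i\<in>I. \<exists>t>0. \<forall>j\<in>I. le i j \<longrightarrow> d z (x j) + t \<le> r" if "(z, r) \<in> J" for z r
  proof -
    have "?w z < r" using that by (simp add: J_def)
    then obtain r' where r': "?w z < r'" "r' < r" using dense[of "?w z" r] by blast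
    then obtain i where i: "i \<in> I" "(SUP j\<in>{j\<in>I. le i j}. d z (x j)) < r'"
      unfolding net_weight_def inf_sup_def INF_less_iff by blast
    have "d z (x j) + (r - r') \<le> r" if j: "j \<in> I" "le i j" for j
    proof -
      have "d z (x j) \<le> (SUP j\<in>{j\<in>I. le i j}. d z (x j))" by (rule SUP_upper) (use j in auto)
      then have "d z (x j) + (r - r') \<le> r' + (r - r')"
        using i(2) by (intro add_right_mono) simp
      also have "\<dots> = r" using r'(2) by (simp add: add_diff_inverse_ennreal)
      finally show ?thesis .
    qed
    moreover have "0 < r - r'" using r'(2) by (simp add: diff_gr0_ennreal order_less_le_trans)
    ultimately show ?thesis using i(1) by blast
  qed
  have up: "\<exists>y s. (y, s) \<in> J \<and> s \<le> e \<and> le' (z, r) (y, s) \<and> le' (z', r') (y, s)"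
    if zr: "(z, r) \<in> J" "(z', r') \<in> J" "0 < e" for z r z' r' e
  proof -
    obtain i t where it: "i \<in> I" "0 < t" "\<forall>j\<in>I. le i j \<longrightarrow> d z (x j) + t \<le> r"
      using ev[OF zr(1)] by blast
    obtain i' t' where it': "i' \<in> I" "0 < t'" "\<forall>j\<in>I. le i' j \<longrightarrow> d z' (x j) + t' \<le> r'"
      using ev[OF zr(2)] by blast
    define s where "s = min e (min t t')"
    have "0 < s" using it it' zr(3) by (simp add: s_def)
    then obtain s' where s': "0 < s'" "s' < s" using dense[of 0 s] by blast
    obtain k where k: "k \<in> I" "\<And>j. j \<in> I \<Longrightarrow> le k j \<Longrightarrow> ?w (x j) \<le> s'"
      using net_weight_small[OF dir fc s'(1)] by blast
    obtain l where "l \<in> I" "le i l" "le i' l"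
      using dir it(1) it'(1) unfolding directed_preorder_def by blast
    then obtain j where j: "j \<in> I" "le i j" "le i' j" "le k j"
      using dir it(1) it'(1) k(1) unfolding directed_preorder_def by meson
    have "(x j, s) \<in> J" using k(2)[OF j(1,4)] s' xX j(1) unfolding J_def by auto
    moreover have "d z (x j) + s \<le> r"
    proof (rule order_trans)
      show "d z (x j) + s \<le> d z (x j) + t" by (intro add_left_mono) (auto simp: s_def min_le_iff_disj)
      show "d z (x j) + t \<le> r" using it(3) j by blast
    qed
    moreover have "d z' (x j) + s \<le> r'"
    proof (rule order_trans)
      show "d z' (x j) + s \<le> d z' (x j) + t'" by (intro add_left_mono) (auto simp: s_def min_le_iff_disj)
      show "d z' (x j) + t' \<le> r'" using it'(3) j by blast
    qed
    ultimately show ?thesis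
      unfolding le'_def by (intro exI[of _ "x j"] exI[of _ s]) (auto simp: s_def)
  qed
  have dir': "directed_preorder J le'"
    unfolding directed_preorder_def
  proof (intro conjI ballI impI)
    obtain i where "i \<in> I" "?w (x i) \<le> 1"
      using net_weight_small[OF dir fc, of 1] dir unfolding directed_preorder_def
      by (metis zero_less_one)
    then have "(x i, top) \<in> J"
      using xX unfolding J_def by (auto intro: le_less_trans)
    then show "J \<noteq> {}" by auto
  next
    fix i assume "i \<in> J"
    then show "le' i i" unfolding le'_def J_def by (auto simp: d0)
  next
    fix i j k assume ijk: "i \<in> J" "j \<in> J" "k \<in> J" and le: "le' i j \<and> le' j k"
    obtain z r z' r' z'' r'' where eq: "i = (z, r)" "j = (z', r')" "k = (z'', r'')"
      by (metis surj_pair)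
    have "d z z'' + r'' \<le> (d z z' + d z' z'') + r''"
      by (rule add_right_mono, rule tri) (use ijk eq in \<open>auto simp: J_def\<close>)
    also have "\<dots> \<le> d z z' + r'"
      using le eq by (auto simp: le'_def add.assoc intro: add_left_mono)
    also have "\<dots> \<le> r" using le eq by (auto simp: le'_def)
    finally show "le' i k" by (simp add: eq le'_def)
  next
    fix i j assume "i \<in> J" "j \<in> J"
    then show "\<exists>k\<in>J. le' i k \<and> le' j k"
      using up[of "fst i" "snd i" "fst j" "snd j" 1] by auto
  qed
  have net': "net_in X J le' fst"
    unfolding net_in_def using dir' by (auto simp: J_def)
  have fc': "forward_cauchy d J le' fst"
  proof -
    let ?F = "INF i\<in>J. SUP (j, k)\<in>{(j, k). j \<in> J \<and> k \<in> J \<and> le' i j \<and> le' j k}. d (fst j) (fst k)"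
    obtain z r where zr: "(z, r) \<in> J" using dir' unfolding directed_preorder_def by auto
    have *: "?F \<le> 0 + ennreal e" if e: "0 < e" for e :: real
    proof -
      obtain y s where ys: "(y, s) \<in> J" "s \<le> ennreal e"
        using up[OF zr zr, of "ennreal e"] e by auto
      have "d (fst j) (fst k) \<le> ennreal e"
        if "le' (y, s) j" "le' j k" for j k
      proof -
        have "d (fst j) (fst k) \<le> snd j" by (rule leD(1)[OF that(2)])
        also have "\<dots> \<le> s" using leD(2)[OF that(1)] by simp
        finally show ?thesis using ys(2) by simp
      qed
      then have "(SUP (j, k)\<in>{(j, k). j \<in> J \<and> k \<in> J \<and> le' (y, s) j \<and> le' j k}. d (fst j) (fst k))
          \<le> ennreal e"
        by (intro SUP_least) auto
      then show ?thesis using INF_lower2[OF ys(1)] by simp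
    qed
    have "?F \<le> 0" by (rule ennreal_le_epsilon) (rule *)
    then show ?thesis unfolding forward_cauchy_def by simp
  qed
  have weq: "net_weight d J le' fst z = ?w z" if z: "z \<in> X" for z
  proof (rule antisym)
    show "net_weight d J le' fst z \<le> ?w z"
    proof (rule dense_ge)
      fix r assume "?w z < r"
      then have "(z, r) \<in> J" using z by (simp add: J_def)
      then show "net_weight d J le' fst z \<le> r"
        unfolding net_weight_def inf_sup_def
        by (rule INF_lower2, intro SUP_least) (use leD(1)[of "(z, r)"] in auto)
    qed
    show "?w z \<le> net_weight d J le' fst z"
      unfolding net_weight_def[of d J] inf_sup_def
    proof (rule INF_greatest)
      fix i assume i: "i \<in> J"
      show "?w z \<le> (SUP j\<in>{j\<in>J. le' i j}. d z (fst j))" (is "_ \<le> ?S")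
      proof (rule ennreal_le_epsilon)
        fix e :: real assume e: "0 < e"
        obtain y s where ys: "(y, s) \<in> J" "s \<le> ennreal e" "le' i (y, s)"
          using up[of "fst i" "snd i" "fst i" "snd i" "ennreal e"] i e by auto
        have "?w z \<le> ?w y + d z y" using w ys(1) z by (auto simp: weight_def J_def)
        also have "\<dots> \<le> ennreal e + ?S"
          using ys by (intro add_mono SUP_upper2[of "(y, s)"]) (auto simp: J_def)
        finally show "?w z \<le> ?S + ennreal e" by (simp add: add.commute)
      qed
    qed
  qed
  show thesis
  proof (rule that[OF net' fc'])
    fix \<phi> assume "weight X d \<phi>"
    then show "inf_sup J le' (\<lambda>j. \<phi> (fst j)) = inf_sup I le (\<lambda>j. \<phi> (x j))"
      using inf_sup_weight[OF net' fc'] inf_sup_weight[OF net fc] weq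
      by (simp add: weight_dist_def)
  qed
qed

lemma dist_weight:
  assumes "gen_metric_space X d" "y \<in> X"
  shows "weight X d (\<lambda>z. d z y)"
  unfolding weight_def
proof (intro ballI)
  fix u v assume "u \<in> X" "v \<in> X"
  then show "d u y \<le> d v y + d u v"
    using assms unfolding gen_metric_space_def by (metis add.commute)
qed

theorem yoneda_complete_any_index:
  fixes I :: "'i set"
  assumes "gen_metric_space X d" "yoneda_complete X d" "net_in X I le x" "forward_cauchy d I le x"
  shows "\<exists>a. yoneda_limit X d I le x a"
proof -
  obtain J :: "'a net_index set" and le' y where J: "net_in X J le' y" "forward_cauchy d J le' y"
    "\<And>\<phi>. weight X d \<phi> \<Longrightarrow> inf_sup J le' (\<lambda>j. \<phi> (y j)) = inf_sup I le (\<lambda>j. \<phi> (x j))"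
    using net_reindex[OF assms(1,3,4)] by blast
  obtain a where "yoneda_limit X d J le' y a"
    using assms(2) J(1,2) unfolding yoneda_complete_def by blast
  then have "yoneda_limit X d I le x a"
    using J(3)[OF dist_weight[OF assms(1)]] unfolding yoneda_limit_def by simp
  then show ?thesis ..
qed

theorem scott_weight_any_index:
  fixes I :: "'i set"
  assumes "gen_metric_space X d" "scott_weight X d \<phi>" "net_in X I le x" "forward_cauchy d I le x"
    "yoneda_limit X d I le x a"
  shows "inf_sup I le (\<lambda>j. \<phi> (x j)) \<ge> \<phi> a"
proof -
  obtain J :: "'a net_index set" and le' y where J: "net_in X J le' y" "forward_cauchy d J le' y"
    "\<And>\<phi>. weight X d \<phi> \<Longrightarrow> inf_sup J le' (\<lambda>j. \<phi> (y j)) = inf_sup I le (\<lambda>j. \<phi> (x j))"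
    using net_reindex[OF assms(1,3,4)] by blast
  have "yoneda_limit X d J le' y a"
    using assms(5) J(3)[OF dist_weight[OF assms(1)]] unfolding yoneda_limit_def by simp
  then have "inf_sup J le' (\<lambda>j. \<phi> (y j)) \<ge> \<phi> a"
    using assms(2) J(1,2) unfolding scott_weight_def by blast
  then show ?thesis
    using J(3) assms(2) unfolding scott_weight_def by simp
qed


section \<open>Independence of the type of test spaces\<close>

definition regular :: "'a set \<Rightarrow> ('a \<Rightarrow> 'a set \<Rightarrow> ennreal) \<Rightarrow> ('a \<Rightarrow> ennreal) \<Rightarrow> bool" where
  "regular X \<delta> \<phi> \<longleftrightarrow> (\<forall>x\<in>X. \<forall>A. A \<subseteq> X \<longrightarrow> \<phi> x \<le> \<delta> x A + (SUP a\<in>A. \<phi> a))"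

lemma approach_spaceD:
  assumes "approach_space X \<delta>" "x \<in> X"
  shows "\<delta> x {x} = 0" "\<delta> x {} = \<infinity>"
    "A \<subseteq> X \<Longrightarrow> B \<subseteq> X \<Longrightarrow> \<delta> x (A \<union> B) = min (\<delta> x A) (\<delta> x B)"
    "A \<subseteq> X \<Longrightarrow> B \<subseteq> X \<Longrightarrow> \<delta> x A \<le> \<delta> x B + (SUP b\<in>B. \<delta> b A)"
  using assms unfolding approach_space_def by simp_all

lemma regularD:
  "regular X \<delta> \<phi> \<Longrightarrow> x \<in> X \<Longrightarrow> A \<subseteq> X \<Longrightarrow> \<phi> x \<le> \<delta> x A + (SUP a\<in>A. \<phi> a)"
  unfolding regular_def by simp

lemma approach_mono:
  assumes "approach_space X \<delta>" "x \<in> X" "A \<subseteq> B" "B \<subseteq> X"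
  shows "\<delta> x B \<le> \<delta> x A"
proof -
  have "\<delta> x (A \<union> B) = min (\<delta> x A) (\<delta> x B)"
    using assms by (intro approach_spaceD(3)) auto
  then show ?thesis using assms(3) by (simp add: Un_absorb1 min_def split: if_splits)
qed

lemma approach_mem:
  assumes "approach_space X \<delta>" "x \<in> A" "A \<subseteq> X"
  shows "\<delta> x A = 0"
proof -
  have "\<delta> x A \<le> \<delta> x {x}" using assms by (intro approach_mono) auto
  also have "\<dots> = 0" using approach_spaceD(1)[OF assms(1)] assms(2,3) by auto
  finally show ?thesis by simp
qed

lemma regular_dist:
  assumes "approach_space X \<delta>" "A \<subseteq> X"
  shows "regular X \<delta> (\<lambda>x. \<delta> x A)"
  unfolding regular_def by (intro ballI allI impI approach_spaceD(4)[OF assms(1) _ assms(2)])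

lemma regular_const:
  assumes "approach_space X \<delta>"
  shows "regular X \<delta> (\<lambda>_. c)"
  unfolding regular_def
proof (intro ballI allI impI)
  fix x A assume x: "x \<in> X" "A \<subseteq> X"
  show "c \<le> \<delta> x A + (SUP a\<in>A. c)"
  proof (cases "A = {}")
    case True
    then show ?thesis using approach_spaceD(2)[OF assms(1) x(1)] by simp
  next
    case False
    then show ?thesis by simp
  qed
qed

lemma regular_min:
  assumes "approach_space X \<delta>" "regular X \<delta> \<phi>" "regular X \<delta> \<psi>"
  shows "regular X \<delta> (\<lambda>x. min (\<phi> x) (\<psi> x))"
  unfolding regular_def
proof (intro ballI allI impI)
  fix x A assume x: "x \<in> X" "A \<subseteq> X"
  let ?B = "{a\<in>A. \<phi> a \<le> \<psi> a}" and ?C = "{a\<in>A. \<psi> a \<le> \<phi> a}"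
  let ?S = "SUP a\<in>A. min (\<phi> a) (\<psi> a)"
  have "A = ?B \<union> ?C" by auto
  then have eq: "\<delta> x A = min (\<delta> x ?B) (\<delta> x ?C)"
    using approach_spaceD(3)[OF assms(1) x(1), of ?B ?C] x(2) by auto
  have B: "min (\<phi> x) (\<psi> x) \<le> \<delta> x ?B + ?S"
  proof -
    have "\<phi> x \<le> \<delta> x ?B + (SUP a\<in>?B. \<phi> a)" using x by (intro regularD[OF assms(2)]) auto
    also have "\<dots> \<le> \<delta> x ?B + ?S" by (intro add_left_mono SUP_mono) auto
    finally show ?thesis by (simp add: min.coboundedI1)
  qed
  have C: "min (\<phi> x) (\<psi> x) \<le> \<delta> x ?C + ?S"
  proof -
    have "\<psi> x \<le> \<delta> x ?C + (SUP a\<in>?C. \<psi> a)" using x by (intro regularD[OF assms(3)]) auto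
    also have "\<dots> \<le> \<delta> x ?C + ?S" by (intro add_left_mono SUP_mono) auto
    finally show ?thesis by (simp add: min.coboundedI2)
  qed
  show "min (\<phi> x) (\<psi> x) \<le> \<delta> x A + ?S"
  proof (cases "\<delta> x ?B \<le> \<delta> x ?C")
    case True
    then have "\<delta> x A = \<delta> x ?B" unfolding eq by (rule min_absorb1)
    then show ?thesis using B by (simp only:)
  next
    case False
    then have "\<delta> x A = \<delta> x ?C" unfolding eq by (intro min_absorb2) simp
    then show ?thesis using C by (simp only:)
  qed
qed

lemma regular_add:
  assumes "regular X \<delta> \<phi>" "approach_space X \<delta>"
  shows "regular X \<delta> (\<lambda>x. \<phi> x + c)"
  unfolding regular_def
proof (intro ballI allI impI)
  fix x A assume x: "x \<in> X" "A \<subseteq> X"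
  show "\<phi> x + c \<le> \<delta> x A + (SUP a\<in>A. \<phi> a + c)"
  proof (cases "A = {}")
    case True
    then show ?thesis using approach_spaceD(2)[OF assms(2) x(1)] by simp
  next
    case False
    have "\<phi> x + c \<le> \<delta> x A + (SUP a\<in>A. \<phi> a) + c"
      using regularD[OF assms(1) x] by (intro add_right_mono)
    also have "\<dots> = \<delta> x A + (SUP a\<in>A. \<phi> a + c)"
      by (simp only: add.assoc ennreal_SUP_add_left[OF False])
    finally show ?thesis .
  qed
qed

lemma regular_ominus:
  assumes "regular X \<delta> \<phi>"
  shows "regular X \<delta> (\<lambda>x. ominus (\<phi> x) c)"
  unfolding regular_def
proof (intro ballI allI impI ominus_le)
  fix x A assume x: "x \<in> X" "A \<subseteq> X"
  have "\<phi> x \<le> \<delta> x A + (SUP a\<in>A. \<phi> a)" by (rule regularD[OF assms x])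
  also have "(SUP a\<in>A. \<phi> a) \<le> (SUP a\<in>A. ominus (\<phi> a) c) + c"
  proof (rule SUP_least)
    fix a assume "a \<in> A"
    have "\<phi> a \<le> ominus (\<phi> a) c + c" by (rule le_add_ominus)
    also have "\<dots> \<le> (SUP a\<in>A. ominus (\<phi> a) c) + c"
      by (intro add_right_mono SUP_upper \<open>a \<in> A\<close>)
    finally show "\<phi> a \<le> (SUP a\<in>A. ominus (\<phi> a) c) + c" .
  qed
  finally show "\<phi> x \<le> \<delta> x A + (SUP a\<in>A. ominus (\<phi> a) c) + c"
    by (simp add: add.assoc add_left_mono)
qed

lemma regular_INF:
  assumes "approach_space X \<delta>" "\<And>k. k < n \<Longrightarrow> regular X \<delta> (\<phi> k)"
  shows "regular X \<delta> (\<lambda>x. INF k\<in>{..<n :: nat}. \<phi> k x)"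
  using assms(2)
proof (induction n)
  case 0
  then show ?case using regular_const[OF assms(1)] by simp
next
  case (Suc n)
  then have "regular X \<delta> (\<lambda>x. min (\<phi> n x) (INF k\<in>{..<n}. \<phi> k x))"
    by (intro regular_min assms(1)) auto
  then show ?case by (simp add: lessThan_Suc inf_min)
qed

text \<open>The power of \<open>[0,\<infinity>]\<close>: its distance is generated by the coordinate functions.\<close>

inductive generated :: "(('k \<Rightarrow> ennreal) \<Rightarrow> ennreal) \<Rightarrow> bool" where
  proj: "generated (\<lambda>p. p k)"
| top: "generated (\<lambda>p. \<infinity>)"
| min: "generated \<phi> \<Longrightarrow> generated \<psi> \<Longrightarrow> generated (\<lambda>p. min (\<phi> p) (\<psi> p))"
| ominus: "generated \<phi> \<Longrightarrow> generated (\<lambda>p. ominus (\<phi> p) c)"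

definition power_dist :: "('k \<Rightarrow> ennreal) \<Rightarrow> ('k \<Rightarrow> ennreal) set \<Rightarrow> ennreal" where
  "power_dist p A = (SUP \<phi>\<in>{\<phi>. generated \<phi> \<and> (\<forall>a\<in>A. \<phi> a = 0)}. \<phi> p)"

lemma approach_power: "approach_space (T :: ('k \<Rightarrow> ennreal) set) power_dist"
  unfolding approach_space_def
proof (intro conjI ballI allI impI)
  fix p :: "'k \<Rightarrow> ennreal"
  show "power_dist p {p} = 0"
    unfolding power_dist_def by (rule antisym, rule SUP_least) auto
  show "power_dist p {} = \<infinity>"
    unfolding power_dist_def
    by (rule antisym) (auto intro!: SUP_upper2[of "\<lambda>p. \<infinity>"] generated.top)
next
  fix p :: "'k \<Rightarrow> ennreal" and A B :: "('k \<Rightarrow> ennreal) set"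
  show "power_dist p (A \<union> B) = min (power_dist p A) (power_dist p B)"
  proof (rule antisym)
    show "power_dist p (A \<union> B) \<le> min (power_dist p A) (power_dist p B)"
      unfolding power_dist_def by (auto intro!: SUP_subset_mono)
    show "min (power_dist p A) (power_dist p B) \<le> power_dist p (A \<union> B)"
    proof (rule dense_le)
      fix t assume "t < min (power_dist p A) (power_dist p B)"
      then have "t < power_dist p A" "t < power_dist p B" by auto
      then obtain \<phi> \<psi> where f: "generated \<phi>" "\<forall>a\<in>A. \<phi> a = 0" "t < \<phi> p"
        and g: "generated \<psi>" "\<forall>a\<in>B. \<psi> a = 0" "t < \<psi> p"
        unfolding power_dist_def less_SUP_iff by blast
      show "t \<le> power_dist p (A \<union> B)"
        unfolding power_dist_def
        by (rule SUP_upper2[of "\<lambda>p. min (\<phi> p) (\<psi> p)"])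
          (use f g in \<open>auto intro: generated.min\<close>)
    qed
  qed
next
  fix p :: "'k \<Rightarrow> ennreal" and A B :: "('k \<Rightarrow> ennreal) set"
  let ?c = "SUP b\<in>B. power_dist b A"
  show "power_dist p A \<le> power_dist p B + ?c"
    unfolding power_dist_def[of p A]
  proof (rule SUP_least)
    fix \<phi> assume "\<phi> \<in> {\<phi>. generated \<phi> \<and> (\<forall>a\<in>A. \<phi> a = 0)}"
    then have \<phi>: "generated \<phi>" "\<forall>a\<in>A. \<phi> a = 0" by auto
    have *: "\<phi> b \<le> ?c" if "b \<in> B" for b
      by (rule SUP_upper2[OF that]) (unfold power_dist_def, rule SUP_upper, use \<phi> in auto)
    have "generated (\<lambda>p. ominus (\<phi> p) ?c)" by (rule generated.ominus[OF \<phi>(1)])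
    moreover have "\<forall>b\<in>B. ominus (\<phi> b) ?c = 0" using * by (simp add: ominus_def)
    ultimately have "ominus (\<phi> p) ?c \<le> power_dist p B"
      unfolding power_dist_def[of p B] by (intro SUP_upper2[of "\<lambda>p. ominus (\<phi> p) ?c"]) simp_all
    then show "\<phi> p \<le> power_dist p B + ?c"
      using le_add_ominus[of "\<phi> p" ?c] by (meson add_right_mono order_trans)
  qed
qed

lemma regular_generated:
  assumes "generated \<phi>" "approach_space X \<delta>" "\<And>k. regular X \<delta> (\<lambda>x. h x k)"
  shows "regular X \<delta> (\<lambda>x. \<phi> (h x))"
  using assms(1)
proof induction
  case (proj k)
  show ?case by (rule assms(3))
next
  case top
  show ?case by (rule regular_const[OF assms(2)])
next
  case (min \<phi> \<psi>)
  show ?case by (rule regular_min[OF assms(2) min.IH])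
next
  case (ominus \<phi> c)
  show ?case by (rule regular_ominus[OF ominus.IH])
qed

lemma power_dist_le:
  assumes "approach_space X \<delta>" "\<And>k. regular X \<delta> (\<lambda>x. h x k)" "x \<in> X" "A \<subseteq> X"
  shows "power_dist (h x) (h ` A) \<le> \<delta> x A"
  unfolding power_dist_def
proof (rule SUP_least)
  fix \<phi> assume "\<phi> \<in> {\<phi>. generated \<phi> \<and> (\<forall>a\<in>h ` A. \<phi> a = 0)}"
  then have \<phi>: "generated \<phi>" "\<forall>a\<in>h ` A. \<phi> a = 0" by auto
  have "\<phi> (h x) \<le> \<delta> x A + (SUP a\<in>A. \<phi> (h a))"
    by (rule regularD[OF regular_generated[OF \<phi>(1) assms(1,2)] assms(3,4)])
  also have "(SUP a\<in>A. \<phi> (h a)) \<le> 0"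
    by (rule SUP_least) (use \<phi>(2) in auto)
  finally show "\<phi> (h x) \<le> \<delta> x A" by (simp add: add_left_mono)
qed

lemma regular_extension:
  assumes X: "approach_space X \<delta>X" and Y: "approach_space Y \<delta>Y"
    and e: "approach_embedding X \<delta>X Y \<delta>Y e" and g: "regular X \<delta>X g"
  shows "\<exists>h. regular Y \<delta>Y h \<and> (\<forall>x\<in>X. h (e x) = g x)"
proof -
  have eY: "\<And>x. x \<in> X \<Longrightarrow> e x \<in> Y"
    and ed: "\<And>x A. x \<in> X \<Longrightarrow> A \<subseteq> X \<Longrightarrow> \<delta>Y (e x) (e ` A) = \<delta>X x A"
    using e unfolding approach_embedding_def contraction_def by auto
  define F where "F = {\<phi>. regular Y \<delta>Y \<phi> \<and> (\<forall>x\<in>X. \<phi> (e x) \<le> g x)}"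
  define h where "h y = (SUP \<phi>\<in>F. \<phi> y)" for y
  have "regular Y \<delta>Y h"
    unfolding regular_def h_def
  proof (intro ballI allI impI SUP_least)
    fix y A \<phi> assume *: "y \<in> Y" "A \<subseteq> Y" "\<phi> \<in> F"
    then have "\<phi> y \<le> \<delta>Y y A + (SUP a\<in>A. \<phi> a)" by (auto simp: F_def intro: regularD)
    also have "\<dots> \<le> \<delta>Y y A + (SUP a\<in>A. SUP \<phi>\<in>F. \<phi> a)"
      by (intro add_left_mono SUP_mono) (use * in \<open>auto intro: SUP_upper\<close>)
    finally show "\<phi> y \<le> \<delta>Y y A + (SUP a\<in>A. SUP \<phi>\<in>F. \<phi> a)" .
  qed
  moreover have "h (e x) = g x" if x: "x \<in> X" for x
  proof (rule antisym)
    show "h (e x) \<le> g x" unfolding h_def by (rule SUP_least) (use x in \<open>auto simp: F_def\<close>)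
    show "g x \<le> h (e x)"
    proof (rule dense_le)
      fix t assume "t < g x"
      then obtain u where u: "t < u" "u < g x" using dense[of t "g x"] by blast
      define \<epsilon> where "\<epsilon> = u - t"
      have tfin: "t < \<infinity>" "u < \<infinity>" using u by (auto intro: less_le_trans)
      have \<epsilon>: "0 < \<epsilon>" "\<epsilon> < \<infinity>"
        unfolding \<epsilon>_def using u tfin by (auto simp: diff_gr0_ennreal diff_less_top_ennreal)
      obtain N :: nat where N: "t \<le> of_nat N * \<epsilon>"
      proof -
        obtain N :: nat where "t / \<epsilon> < of_nat N"
          using ennreal_Ex_less_of_nat[of "t / \<epsilon>"] tfin \<epsilon>
          by (auto simp: ennreal_divide_eq_top_iff simp flip: less_top)
        then have "t / \<epsilon> * \<epsilon> \<le> of_nat N * \<epsilon>" by (intro mult_right_mono) auto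
        moreover have "t / \<epsilon> * \<epsilon> = t"
          using \<epsilon> by (simp add: ennreal_divide_times ennreal_divide_self less_top mult_divide_eq_ennreal)
        ultimately show thesis using that by simp
      qed
      define A where "A k = {x\<in>X. g x \<le> of_nat (Suc k) * \<epsilon>}" for k
      define \<phi> where "\<phi> y = min (of_nat N * \<epsilon>)
        (INF k\<in>{..<N}. \<delta>Y y (e ` A k) + of_nat k * \<epsilon>)" for y
      have AX: "A k \<subseteq> X" for k by (auto simp: A_def)
      then have AY: "e ` A k \<subseteq> Y" for k using eY by blast
      have "regular Y \<delta>Y \<phi>"
        unfolding \<phi>_def
        by (intro regular_min regular_const regular_INF regular_add regular_dist Y AY)
      moreover have "\<phi> (e z) \<le> g z" if z: "z \<in> X" for z
      proof (cases "of_nat N * \<epsilon> \<le> g z")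
        case True
        then show ?thesis unfolding \<phi>_def by (simp add: min.coboundedI1)
      next
        case False
        define k where "k = (LEAST k. g z < of_nat (Suc k) * \<epsilon>)"
        have N0: "N \<noteq> 0" using False by (cases N) auto
        have ex: "g z < of_nat (Suc (N - 1)) * \<epsilon>" using False N0 by (simp add: not_le)
        have k: "g z < of_nat (Suc k) * \<epsilon>" unfolding k_def using ex by (rule LeastI)
        have "k \<le> N - 1" unfolding k_def using ex by (rule Least_le)
        then have kN: "k < N" using N0 by simp
        have kg: "of_nat k * \<epsilon> \<le> g z"
        proof (cases k)
          case (Suc m)
          then have "\<not> g z < of_nat (Suc m) * \<epsilon>"
            using not_less_Least[of m "\<lambda>k. g z < of_nat (Suc k) * \<epsilon>"] k_def by simp
          then show ?thesis using Suc by (simp add: not_less)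
        qed simp
        have "e z \<in> e ` A k" using z k by (auto simp: A_def)
        then have "\<delta>Y (e z) (e ` A k) = 0" by (intro approach_mem[OF Y] AY)
        then have "(INF k\<in>{..<N}. \<delta>Y (e z) (e ` A k) + of_nat k * \<epsilon>) \<le> g z"
          using kN kg by (intro INF_lower2[of k]) auto
        then show ?thesis unfolding \<phi>_def by (simp add: min.coboundedI2)
      qed
      ultimately have "\<phi> \<in> F" by (auto simp: F_def)
      then have "\<phi> (e x) \<le> h (e x)" unfolding h_def by (rule SUP_upper)
      moreover have "t \<le> \<phi> (e x)"
        unfolding \<phi>_def
      proof (intro min.boundedI N INF_greatest)
        fix k
        have "g x \<le> \<delta>X x (A k) + (SUP a\<in>A k. g a)"
            by (rule regularD[OF g x AX])
        also have "\<dots> \<le> \<delta>X x (A k) + (of_nat k * \<epsilon> + \<epsilon>)"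
          by (intro add_left_mono SUP_least) (auto simp: A_def distrib_right add.commute)
        finally have "t + \<epsilon> \<le> (\<delta>X x (A k) + of_nat k * \<epsilon>) + \<epsilon>"
          using u by (simp add: \<epsilon>_def add_diff_inverse_ennreal add.assoc)
        then show "t \<le> \<delta>Y (e x) (e ` A k) + of_nat k * \<epsilon>"
          using \<epsilon> by (auto simp: ed[OF x AX] ennreal_add_left_cancel_le add.commute[of _ \<epsilon>])
      qed
      ultimately show "t \<le> h (e x)" by simp
    qed
  qed
  ultimately show ?thesis by blast
qed

theorem injective_approach_any_type:
  assumes "injective_approach Z \<delta>"
  shows "extends_along_embeddings TYPE('u) TYPE('v) Z \<delta>"
  unfolding extends_along_embeddings_def
proof (intro allI impI, elim conjE)
  fix X :: "'u set" and \<delta>X and Y :: "'v set" and \<delta>Y e f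
  assume X: "approach_space X \<delta>X" and Y: "approach_space Y \<delta>Y"
    and e: "approach_embedding X \<delta>X Y \<delta>Y e" and f: "contraction X \<delta>X Z \<delta> f"
  have Z: "approach_space Z \<delta>" and T0: "T0_approach Z \<delta>"
    and inj: "extends_along_embeddings TYPE('a set \<Rightarrow> ennreal) TYPE('a set \<Rightarrow> ennreal) Z \<delta>"
    using assms unfolding injective_approach_def by auto
  define q where "q z = (\<lambda>A. \<delta> z (A \<inter> Z))" for z
  have qreg: "regular Z \<delta> (\<lambda>z. q z A)" for A
    unfolding q_def by (rule regular_dist[OF Z]) auto
  have qd: "power_dist (q z) (q ` A) = \<delta> z A" if "z \<in> Z" "A \<subseteq> Z" for z A
  proof (rule antisym[OF power_dist_le[OF Z qreg that]])
    have "\<delta> z A = q z A" using that by (simp add: q_def Int_absorb2)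
    also have "\<dots> \<le> power_dist (q z) (q ` A)"
      unfolding power_dist_def
      by (rule SUP_upper2[of "\<lambda>p. p A"])
        (use that in \<open>auto intro: generated.proj simp: q_def Int_absorb2 approach_mem[OF Z]\<close>)
    finally show "\<delta> z A \<le> power_dist (q z) (q ` A)" .
  qed
  have qinj: "inj_on q Z"
  proof (rule inj_onI)
    fix z w assume zw: "z \<in> Z" "w \<in> Z" "q z = q w"
    have "\<delta> z {w} = \<delta> w {w}" using fun_cong[OF zw(3), of "{w}"] zw by (simp add: q_def)
    moreover have "\<delta> w {z} = \<delta> z {z}" using fun_cong[OF zw(3), of "{z}"] zw by (simp add: q_def)
    ultimately show "z = w"
      using T0 zw approach_spaceD(1)[OF Z] unfolding T0_approach_def by simp
  qed
  let ?r = "the_inv_into Z q"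
  have rq: "?r (q z) = z" if "z \<in> Z" for z using the_inv_into_f_f[OF qinj that] .
  have "contraction (q ` Z) power_dist Z \<delta> ?r"
    unfolding contraction_def
  proof (intro conjI ballI allI impI)
    show "?r \<in> q ` Z \<rightarrow> Z" using rq by auto
  next
    fix p A assume "p \<in> q ` Z" "A \<subseteq> q ` Z"
    then obtain z B where "z \<in> Z" "p = q z" "B \<subseteq> Z" "A = q ` B"
      by (metis imageE subset_imageE)
    moreover from this have "?r ` A = B" using rq by (force simp: image_image)
    ultimately show "\<delta> (?r p) (?r ` A) \<le> power_dist p A" by (simp add: rq qd)
  qed
  moreover have "approach_embedding (q ` Z) power_dist UNIV power_dist (\<lambda>p. p)"
    unfolding approach_embedding_def contraction_def by simp
  ultimately have "\<exists>s. contraction UNIV power_dist Z \<delta> s \<and> (\<forall>p\<in>q ` Z. s p = ?r p)"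
    using inj[unfolded extends_along_embeddings_def, rule_format,
        of "q ` Z" power_dist UNIV power_dist "\<lambda>p. p" ?r] approach_power by blast
  then obtain s where s: "contraction UNIV power_dist Z \<delta> s" "\<And>z. z \<in> Z \<Longrightarrow> s (q z) = z"
    using rq by auto
  have "\<exists>h. regular Y \<delta>Y h \<and> (\<forall>x\<in>X. h (e x) = q (f x) A)" for A
  proof (rule regular_extension[OF X Y e])
    show "regular X \<delta>X (\<lambda>x. q (f x) A)"
      unfolding regular_def
    proof (intro ballI allI impI)
      fix x B assume x: "x \<in> X" "B \<subseteq> X"
      have fZ: "f x \<in> Z" "f ` B \<subseteq> Z" and fd: "\<delta> (f x) (f ` B) \<le> \<delta>X x B"
        using f x unfolding contraction_def by auto
      have "q (f x) A \<le> \<delta> (f x) (f ` B) + (SUP z\<in>f ` B. q z A)"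
        by (rule regularD[OF qreg fZ])
      also have "\<dots> \<le> \<delta>X x B + (SUP b\<in>B. q (f b) A)"
        using fd by (simp add: image_image add_right_mono)
      finally show "q (f x) A \<le> \<delta>X x B + (SUP b\<in>B. q (f b) A)" .
    qed
  qed
  then obtain H where H: "\<And>A. regular Y \<delta>Y (H A)" "\<And>A x. x \<in> X \<Longrightarrow> H A (e x) = q (f x) A"
    by metis
  define h where "h y = (\<lambda>A. H A y)" for y
  have "contraction Y \<delta>Y Z \<delta> (\<lambda>y. s (h y))"
    unfolding contraction_def
  proof (intro conjI ballI allI impI)
    show "(\<lambda>y. s (h y)) \<in> Y \<rightarrow> Z" using s(1) unfolding contraction_def by auto
  next
    fix y A assume y: "y \<in> Y" "A \<subseteq> Y"
    have "\<delta> (s (h y)) (s ` h ` A) \<le> power_dist (h y) (h ` A)"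
      using s(1) unfolding contraction_def by blast
    also have "\<dots> \<le> \<delta>Y y A"
      by (rule power_dist_le[OF Y _ y]) (simp add: h_def H(1))
    finally show "\<delta> (s (h y)) ((\<lambda>y. s (h y)) ` A) \<le> \<delta>Y y A" by (simp add: image_image)
  qed
  moreover have "s (h (e x)) = f x" if "x \<in> X" for x
  proof -
    have "h (e x) = q (f x)" using H(2)[OF that] by (auto simp: h_def)
    moreover have "f x \<in> Z" using f that unfolding contraction_def by auto
    ultimately show ?thesis using s(2) by simp
  qed
  ultimately show "\<exists>g. contraction Y \<delta>Y Z \<delta> g \<and> (\<forall>x\<in>X. g (e x) = f x)" by blast
qed

end

theory Submission
  imports Defs
begin

text \<open>
  The distances \<open>q x = (A \<mapsto> \<delta> x A)\<close> embed \<open>X\<close> into a power of \<open>[0,\<infinity>]\<close>, and injectivity yields a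
  contraction \<open>r\<close> back with \<open>r \<circ> q = id\<close>. Colimits in the power are the coordinatewise suprema of
  \<open>q x k \<ominus> \<phi> x\<close>, and \<open>r\<close> sends them to colimits in \<open>X\<close>. A flat weight is directed in the
  approximate sense, so its colimit in the power is in the closure of the points of small weight;
  hence regular functions are Scott weights. Conversely \<open>x\<close> is the Yoneda limit of the points \<open>r u\<close>
  for finitely supported \<open>u\<close> with \<open>u k < q x k\<close> on the support. Evaluated along this net, a Scott
  weight is bounded by the distance, and the weight of the net is the value at \<open>x\<close> of the left
  adjoint of \<open>colim\<close>.
\<close>

section \<open>Truncated subtraction, weight distance and tensor\<close>

lemma ominus_le_iff: "ominus a b \<le> c \<longleftrightarrow> a \<le> c + b"
  using le_add_ominus[of a b] by (meson add_right_mono ominus_le order_trans)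

lemma less_ominus_iff: "c < ominus a b \<longleftrightarrow> c + b < a"
  by (simp only: not_le[symmetric] ominus_le_iff)

lemma weight_dist_le_iff: "weight_dist X \<phi> \<psi> \<le> c \<longleftrightarrow> (\<forall>x\<in>X. \<psi> x \<le> c + \<phi> x)"
  by (simp add: weight_dist_def SUP_le_iff ominus_le_iff)

lemma weight_dist_cong:
  assumes "\<And>x. x \<in> X \<Longrightarrow> \<phi> x = \<phi>' x" "\<And>x. x \<in> X \<Longrightarrow> \<psi> x = \<psi>' x"
  shows "weight_dist X \<phi> \<psi> = weight_dist X \<phi>' \<psi>'"
  unfolding weight_dist_def by (intro SUP_cong refl) (simp add: assms)

lemma weight_dist_yoneda:
  "weight_dist X \<phi> (yoneda X d y) = weight_dist X \<phi> (\<lambda>z. d z y)"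
  by (rule weight_dist_cong) (simp_all add: yoneda_def)

lemma tensor_cong:
  assumes "\<And>x. x \<in> X \<Longrightarrow> \<phi> x = \<phi>' x"
  shows "tensor X \<phi> \<psi> = tensor X \<phi>' \<psi>"
  unfolding tensor_def by (intro INF_cong refl) (simp add: assms)

lemma flat_restrict: "flat X d \<phi> \<Longrightarrow> flat X d (restrict \<phi> X)"
  using tensor_cong[of X "restrict \<phi> X" \<phi>] INF_cong[of X X "restrict \<phi> X" \<phi>]
  by (simp add: flat_def weight_def)

lemma tensor_lessE:
  assumes "tensor X \<phi> \<psi> < c"
  obtains x where "x \<in> X" "\<phi> x + \<psi> x < c"
  using assms unfolding tensor_def INF_less_iff by blast

section \<open>Flat weights\<close>

lemma tensor_const_le:
  assumes "(INF x\<in>X. \<phi> x) = (0 :: ennreal)"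
  shows "tensor X \<phi> (\<lambda>_. c) \<le> c"
proof (rule ennreal_le_epsilon)
  fix e :: real assume "0 < e"
  then have "(INF x\<in>X. \<phi> x) < ennreal e" using assms by simp
  then obtain x where "x \<in> X" "\<phi> x < ennreal e" unfolding INF_less_iff by blast
  then show "tensor X \<phi> (\<lambda>_. c) \<le> c + ennreal e"
    unfolding tensor_def by (intro INF_lower2[of x]) (auto simp: add.commute add_left_mono)
qed

text \<open>Flatness is applied to the coweights \<open>d y\<close> and the constant
  \<open>\<phi> y\<close>. Both have tensor at most \<open>\<phi> y\<close>, the first by evaluation
  at \<open>y\<close>, so their maximum has too; a finite \<open>\<phi> y\<close> then
  cancels.\<close>

lemma tensor_dist_ominus:
  assumes met: "gen_metric_space X d" and flat: "flat X d \<phi>" and y: "y \<in> X"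
  shows "tensor X \<phi> (\<lambda>z. ominus (d y z) (\<phi> y)) = 0"
proof (cases "\<phi> y = top")
  \<comment> \<open>Subtracting \<infinity> gives 0 everywhere, even from \<infinity>, so the
    coweight is constantly 0.\<close>
  case True
  then have "tensor X \<phi> (\<lambda>z. ominus (d y z) (\<phi> y)) = tensor X \<phi> (\<lambda>_. 0)"
    by (simp add: ominus_def)
  also have "\<dots> \<le> 0" by (rule tensor_const_le) (use flat in \<open>simp add: flat_def\<close>)
  finally show ?thesis by simp
next
  case False
  have "coweight X d (d y)" "coweight X d (\<lambda>_. \<phi> y)"
    using met y by (auto simp: coweight_def gen_metric_space_def)
  then have "tensor X \<phi> (\<lambda>z. max (d y z) (\<phi> y)) = max (tensor X \<phi> (d y)) (tensor X \<phi> (\<lambda>_. \<phi> y))"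
    using flat unfolding flat_def by blast
  moreover have "tensor X \<phi> (d y) \<le> \<phi> y"
    unfolding tensor_def by (rule INF_lower2[OF y]) (use met y in \<open>simp add: gen_metric_space_def\<close>)
  moreover have "tensor X \<phi> (\<lambda>_. \<phi> y) \<le> \<phi> y"
    by (rule tensor_const_le) (use flat in \<open>simp add: flat_def\<close>)
  ultimately have le: "tensor X \<phi> (\<lambda>z. max (d y z) (\<phi> y)) \<le> \<phi> y" by simp
  have "tensor X \<phi> (\<lambda>z. ominus (d y z) (\<phi> y)) \<le> 0"
  proof (rule ennreal_le_epsilon)
    fix e :: real assume "0 < e"
    then have "\<phi> y < \<phi> y + ennreal e"
      using False ennreal_add_left_cancel_less[of "\<phi> y" 0] by auto
    with le have "tensor X \<phi> (\<lambda>z. max (d y z) (\<phi> y)) < \<phi> y + ennreal e" by (rule le_less_trans)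
    then obtain z where z: "z \<in> X" "\<phi> z + max (d y z) (\<phi> y) < \<phi> y + ennreal e"
      by (rule tensor_lessE)
    have "max (d y z) (\<phi> y) = \<phi> y + ominus (d y z) (\<phi> y)"
      using False
      by (cases "d y z \<le> \<phi> y") (auto simp: ominus_def max_def add_diff_inverse_ennreal)
    then have "\<phi> y + (\<phi> z + ominus (d y z) (\<phi> y)) < \<phi> y + ennreal e"
      using z(2) by (simp add: ac_simps)
    then have "\<phi> z + ominus (d y z) (\<phi> y) < ennreal e"
      by (meson add_left_mono not_le)
    then show "tensor X \<phi> (\<lambda>z. ominus (d y z) (\<phi> y)) \<le> 0 + ennreal e"
      unfolding tensor_def using z(1) by (intro INF_lower2[of z]) auto
  qed
  then show ?thesis by simp
qed

text \<open>The coweights of \<open>tensor_dist_ominus\<close> have tensor 0 with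
  \<open>\<phi>\<close>, and flatness preserves this under finite maxima. A point where
  \<open>\<phi>\<close> plus the maximum is below \<open>\<epsilon>\<close> satisfies all the bounds
  at once.\<close>

lemma flat_directed:
  assumes met: "gen_metric_space X d" and flat: "flat X d \<phi>"
    and "finite S" "S \<subseteq> X" and "0 < \<epsilon>"
  obtains z where "z \<in> X" "\<phi> z < \<epsilon>" "\<And>y. y \<in> S \<Longrightarrow> d y z \<le> \<phi> y + \<epsilon>"
proof -
  let ?\<psi> = "\<lambda>S z. SUP y\<in>S. ominus (d y z) (\<phi> y)"
  have coweight: "coweight X d (\<lambda>z. ominus (d y z) (\<phi> y))" if y: "y \<in> X" for y
    unfolding coweight_def
  proof (intro ballI ominus_le)
    fix u v assume uv: "u \<in> X" "v \<in> X"
    have "d y v \<le> d y u + d u v" using met y uv by (simp add: gen_metric_space_def)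
    also have "d y u \<le> ominus (d y u) (\<phi> y) + \<phi> y" by (rule le_add_ominus)
    finally show "d y v \<le> ominus (d y u) (\<phi> y) + d u v + \<phi> y"
      by (simp add: ac_simps add_left_mono)
  qed
  \<comment> \<open>The induction also carries the coweight property, since flatness speaks only of
    maxima of coweights.\<close>
  have "coweight X d (?\<psi> S) \<and> tensor X \<phi> (?\<psi> S) = 0"
    using \<open>finite S\<close> \<open>S \<subseteq> X\<close>
  proof induction
    case empty
    have "tensor X \<phi> (\<lambda>_. 0) \<le> 0"
      by (rule tensor_const_le) (use flat in \<open>simp add: flat_def\<close>)
    then show ?case by (simp add: coweight_def bot_ennreal)
  next
    case (insert y S)
    then have y: "y \<in> X" and IH: "coweight X d (?\<psi> S)" "tensor X \<phi> (?\<psi> S) = 0" by auto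
    have eq: "?\<psi> (insert y S) = (\<lambda>z. max (ominus (d y z) (\<phi> y)) (?\<psi> S z))"
      by (simp add: sup_max)
    have "tensor X \<phi> (?\<psi> (insert y S)) = 0"
      unfolding eq using flat coweight[OF y] IH tensor_dist_ominus[OF met flat y]
      by (simp add: flat_def)
    moreover have "coweight X d (?\<psi> (insert y S))"
      unfolding eq coweight_def
    proof (intro ballI max.boundedI)
      fix u v assume uv: "u \<in> X" "v \<in> X"
      have "ominus (d y v) (\<phi> y) \<le> ominus (d y u) (\<phi> y) + d u v" "?\<psi> S v \<le> ?\<psi> S u + d u v"
        using coweight[OF y] IH(1) uv unfolding coweight_def by auto
      then show "ominus (d y v) (\<phi> y) \<le> max (ominus (d y u) (\<phi> y)) (?\<psi> S u) + d u v"
        "?\<psi> S v \<le> max (ominus (d y u) (\<phi> y)) (?\<psi> S u) + d u v"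
        by (meson add_right_mono max.cobounded1 max.cobounded2 order_trans)+
    qed
    ultimately show ?case by blast
  qed
  then have "tensor X \<phi> (?\<psi> S) < \<epsilon>" using \<open>0 < \<epsilon>\<close> by simp
  then obtain z where z: "z \<in> X" "\<phi> z + ?\<psi> S z < \<epsilon>" by (rule tensor_lessE)
  show thesis
  proof (rule that[OF z(1)])
    have "\<phi> z \<le> \<phi> z + ?\<psi> S z" by simp
    then show "\<phi> z < \<epsilon>" using z(2) by (rule le_less_trans)
    fix y assume "y \<in> S"
    then have "ominus (d y z) (\<phi> y) \<le> ?\<psi> S z" by (rule SUP_upper)
    also have "\<dots> \<le> \<phi> z + ?\<psi> S z" by simp
    also have "\<dots> \<le> \<epsilon>" using z(2) by simp
    finally show "d y z \<le> \<phi> y + \<epsilon>" by (simp add: ominus_le_iff add.commute)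
  qed
qed

section \<open>Weights of forward Cauchy nets, colimits and Yoneda limits\<close>

lemma net_weight_lessE:
  assumes "net_weight d I le x z < c"
  obtains i where "i \<in> I" "\<And>j. j \<in> I \<Longrightarrow> le i j \<Longrightarrow> d z (x j) < c"
proof -
  obtain i where i: "i \<in> I" "(SUP j\<in>{j\<in>I. le i j}. d z (x j)) < c"
    using assms unfolding net_weight_def inf_sup_def INF_less_iff by blast
  show thesis
  proof (rule that[OF i(1)])
    fix j assume "j \<in> I" "le i j"
    then have "d z (x j) \<le> (SUP j\<in>{j\<in>I. le i j}. d z (x j))" by (intro SUP_upper) auto
    then show "d z (x j) < c" using i(2) by (rule le_less_trans)
  qed
qed

text \<open>A coweight whose tensor with the net weight is below \<open>c\<close> is eventually
  below \<open>c\<close> along the net. For two coweights this happens at a common index, which can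
  be taken so late that the net weight there is small too.\<close>

lemma flat_net_weight:
  assumes met: "gen_metric_space X d" and net: "net_in X I le x" and fc: "forward_cauchy d I le x"
  shows "flat X d (net_weight d I le x)"
proof -
  let ?w = "net_weight d I le x"
  have dir: "directed_preorder I le" and xX: "\<And>j. j \<in> I \<Longrightarrow> x j \<in> X"
    using net unfolding net_in_def by auto
  have eventually_less: "\<exists>i\<in>I. \<forall>j\<in>I. le i j \<longrightarrow> \<psi> (x j) < c"
    if \<psi>: "coweight X d \<psi>" and less: "tensor X ?w \<psi> < c" for \<psi> c
  proof -
    obtain z where z: "z \<in> X" "?w z + \<psi> z < c" using less by (rule tensor_lessE)
    then have fin: "\<psi> z \<noteq> top" by auto
    \<comment> \<open>As \<open>\<psi> z\<close> is finite, the strict bound leaves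
      \<open>c - \<psi> z\<close> for the eventual distances from \<open>z\<close>.\<close>
    have "?w z < c - \<psi> z"
      using z(2) fin by (simp add: less_diff_eq_ennreal less_top)
    then obtain i where i: "i \<in> I" "\<And>j. j \<in> I \<Longrightarrow> le i j \<Longrightarrow> d z (x j) < c - \<psi> z"
      by (rule net_weight_lessE) blast
    have "\<psi> (x j) < c" if "j \<in> I" "le i j" for j
    proof -
      have "\<psi> (x j) \<le> d z (x j) + \<psi> z"
        using \<psi> z(1) xX[OF that(1)] by (simp add: coweight_def add.commute)
      also have "\<dots> < c" using i(2)[OF that] fin by (simp add: less_diff_eq_ennreal less_top)
      finally show ?thesis .
    qed
    then show ?thesis using i(1) by blast
  qed
  have small: "\<exists>i\<in>I. \<forall>j\<in>I. le i j \<longrightarrow> ?w (x j) \<le> e" if "0 < e" for e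
    using net_weight_small[OF dir fc that] by metis
  show ?thesis
    unfolding flat_def
  proof (intro conjI allI impI)
    show "weight X d ?w" by (rule net_weight_weight[OF met net])
    have "(INF z\<in>X. ?w z) \<le> 0"
    proof (rule ennreal_le_epsilon)
      fix e :: real assume "0 < e"
      then obtain i where i: "i \<in> I" "\<forall>j\<in>I. le i j \<longrightarrow> ?w (x j) \<le> ennreal e"
        using small[of "ennreal e"] by auto
      moreover have "le i i" using dir i(1) unfolding directed_preorder_def by blast
      ultimately show "(INF z\<in>X. ?w z) \<le> 0 + ennreal e" using xX by (intro INF_lower2[of "x i"]) auto
    qed
    then show "(INF z\<in>X. ?w z) = 0" by simp
  next
    fix \<psi>1 \<psi>2 assume \<psi>: "coweight X d \<psi>1 \<and> coweight X d \<psi>2"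
    let ?t = "\<lambda>\<psi>. tensor X ?w \<psi>"
    show "?t (\<lambda>z. max (\<psi>1 z) (\<psi>2 z)) = max (?t \<psi>1) (?t \<psi>2)"
    proof (rule antisym)
      show "max (?t \<psi>1) (?t \<psi>2) \<le> ?t (\<lambda>z. max (\<psi>1 z) (\<psi>2 z))"
        unfolding tensor_def by (intro max.boundedI INF_mono' add_left_mono) auto
      show "?t (\<lambda>z. max (\<psi>1 z) (\<psi>2 z)) \<le> max (?t \<psi>1) (?t \<psi>2)"
      proof (rule dense_ge)
        fix c assume "max (?t \<psi>1) (?t \<psi>2) < c"
        then obtain i1 i2 where i: "i1 \<in> I" "\<forall>j\<in>I. le i1 j \<longrightarrow> \<psi>1 (x j) < c"
            "i2 \<in> I" "\<forall>j\<in>I. le i2 j \<longrightarrow> \<psi>2 (x j) < c"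
          using eventually_less[of \<psi>1 c] eventually_less[of \<psi>2 c] \<psi> by auto
        show "?t (\<lambda>z. max (\<psi>1 z) (\<psi>2 z)) \<le> c"
        proof (rule ennreal_le_epsilon)
          fix e :: real assume "0 < e"
          then obtain i3 where i3: "i3 \<in> I" "\<forall>j\<in>I. le i3 j \<longrightarrow> ?w (x j) \<le> ennreal e"
            using small[of "ennreal e"] by auto
          obtain l where "l \<in> I" "le i1 l" "le i2 l"
            using dir i unfolding directed_preorder_def by blast
          then obtain j where j: "j \<in> I" "le i1 j" "le i2 j" "le i3 j"
            using dir i i3(1) unfolding directed_preorder_def by meson
          have "?w (x j) + max (\<psi>1 (x j)) (\<psi>2 (x j)) \<le> ennreal e + c"
            using i i3 j by (intro add_mono) auto
          then show "?t (\<lambda>z. max (\<psi>1 z) (\<psi>2 z)) \<le> c + ennreal e"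
            unfolding tensor_def using xX[OF j(1)]
            by (intro INF_lower2[of "x j"]) (auto simp: add.commute)
        qed
      qed
    qed
  qed
qed

text \<open>By \<open>inf_sup_weight\<close> for the representable weights, both sides are the same
  condition on the distances \<open>d a y\<close>.\<close>

lemma is_colimit_net_weight:
  assumes "gen_metric_space X d" "net_in X I le x" "forward_cauchy d I le x"
  shows "is_colimit X d (net_weight d I le x) a \<longleftrightarrow> yoneda_limit X d I le x a"
  unfolding is_colimit_def yoneda_limit_def weight_dist_yoneda
  using inf_sup_weight[OF assms(2,3) dist_weight[OF assms(1)]] by auto

lemma is_colimit_cong:
  assumes "\<And>x. x \<in> X \<Longrightarrow> \<phi> x = \<phi>' x"
  shows "is_colimit X d \<phi> a \<longleftrightarrow> is_colimit X d \<phi>' a"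
  unfolding is_colimit_def using weight_dist_cong[of X \<phi> \<phi>' \<psi> \<psi> for \<psi>] assms by auto

lemma is_colimit_unique:
  assumes "gen_metric_space X d" "separated X d" "is_colimit X d \<phi> a" "is_colimit X d \<phi> b"
  shows "a = b"
proof -
  have ab: "a \<in> X" "b \<in> X" and eq: "\<And>y. y \<in> X \<Longrightarrow> d a y = d b y"
    using assms(3,4) unfolding is_colimit_def by auto
  have "d a a = 0" "d b b = 0" using assms(1) ab by (simp_all add: gen_metric_space_def)
  then have "d a b = 0" "d b a = 0" using eq ab by metis+
  then show ?thesis using assms(2) ab by (simp add: separated_def)
qed

lemma cocomplete_imp_yoneda_complete:
  assumes "gen_metric_space X d" "cocomplete X d"
  shows "yoneda_complete X d"
  unfolding yoneda_complete_def
proof (intro allI impI, elim conjE)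
  fix I :: "'a net_index set" and le x
  assume net: "net_in X I le x" "forward_cauchy d I le x"
  let ?w = "net_weight d I le x"
  \<comment> \<open>The colimit of the net weight will be the Yoneda limit; \<open>restrict\<close>
    gives the extensional representative.\<close>
  have "restrict ?w X \<in> weights X d"
    using net_weight_weight[OF assms(1) net(1)] by (simp add: weights_def weight_def)
  then obtain a where "is_colimit X d (restrict ?w X) a"
    using assms(2) unfolding cocomplete_def by blast
  then have "is_colimit X d ?w a" using is_colimit_cong[of X "restrict ?w X" ?w] by simp
  then show "\<exists>a. yoneda_limit X d I le x a"
    using is_colimit_net_weight[OF assms(1) net] by blast
qed

text \<open>By directedness, each tail of an increasing net already has the supremum of the whole
  net.\<close>

lemma inf_sup_increasing:
  assumes "directed_preorder I le" "\<And>i j. i \<in> I \<Longrightarrow> j \<in> I \<Longrightarrow> le i j \<Longrightarrow> g i \<le> g j"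
  shows "inf_sup I le g = (SUP i\<in>I. g i)"
proof -
  have upper_bound: "\<forall>i\<in>I. \<forall>j\<in>I. \<exists>k\<in>I. le i k \<and> le j k"
    using assms(1) unfolding directed_preorder_def by (elim conjE)
  have "(SUP j\<in>{j\<in>I. le i j}. g j) = (SUP i\<in>I. g i)" if "i \<in> I" for i
  proof (rule antisym)
    show "(SUP j\<in>{j\<in>I. le i j}. g j) \<le> (SUP i\<in>I. g i)" by (intro SUP_subset_mono) auto
    show "(SUP i\<in>I. g i) \<le> (SUP j\<in>{j\<in>I. le i j}. g j)"
    proof (rule SUP_least)
      fix k assume "k \<in> I"
      with that upper_bound obtain j where j: "j \<in> I" "le i j" "le k j" by blast
      then have "g k \<le> g j" using assms(2) \<open>k \<in> I\<close> by blast
      then show "g k \<le> (SUP j\<in>{j\<in>I. le i j}. g j)"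
        using j by (intro SUP_upper2[of j]) simp_all
    qed
  qed
  then have "inf_sup I le g = (INF i\<in>I. SUP i\<in>I. g i)" unfolding inf_sup_def by (intro INF_cong refl)
  also have "\<dots> = (SUP i\<in>I. g i)"
    using assms(1) unfolding directed_preorder_def by (intro INF_const) (elim conjE)
  finally show ?thesis .
qed

section \<open>The power of \<open>[0,\<infinity>]\<close>\<close>

text \<open>By induction on its generation, a generated function increases by at most
  \<open>c\<close> from \<open>p'\<close> to \<open>p\<close>; the functions that count vanish at
  \<open>p'\<close>.\<close>

lemma power_dist_singleton_le:
  assumes "\<And>k. p k \<le> p' k + c"
  shows "power_dist p {p'} \<le> c"
proof -
  have "\<phi> p \<le> \<phi> p' + c" if "generated \<phi>" for \<phi>
    using that
  proof induction
    case (ominus \<phi> b)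
    have "\<phi> p' \<le> ominus (\<phi> p') b + b" by (rule le_add_ominus)
    with ominus.IH have "\<phi> p \<le> ominus (\<phi> p') b + b + c" by (meson add_right_mono order_trans)
    then show ?case by (intro ominus_le) (simp add: ac_simps)
  next
    case (min \<phi> \<psi>)
    then show ?case by (auto simp: min_def intro: order_trans)
  qed (simp_all add: assms)
  then show ?thesis unfolding power_dist_def by (intro SUP_least) fastforce
qed

text \<open>
  The distance of \<open>b\<close> to \<open>A\<close> vanishes iff \<open>b\<close> lies in the closure of \<open>A\<close> for the product of the
  upper topologies; subbasic open sets are given by pairs \<open>(k, s)\<close>.
\<close>

lemma power_dist_eq_0:
  assumes "\<And>S. finite S \<Longrightarrow> \<forall>(k, s)\<in>S. s < b k \<Longrightarrow> \<exists>p\<in>A. \<forall>(k, s)\<in>S. s < p k"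
  shows "power_dist b A = 0"
proof -
  \<comment> \<open>Generated functions are lower semicontinuous: each strict lower bound at
    \<open>b\<close> holds on a basic neighbourhood of \<open>b\<close>. For \<open>ominus\<close>,
    the induction hypothesis is used at the threshold \<open>t + c\<close>.\<close>
  have nbhd: "\<exists>S. finite S \<and> (\<forall>(k, s)\<in>S. s < b k) \<and> (\<forall>p. (\<forall>(k, s)\<in>S. s < p k) \<longrightarrow> t < \<phi> p)"
    if "generated \<phi>" "t < \<phi> b" for \<phi> t
    using that
  proof (induction arbitrary: t)
    case (proj k)
    then show ?case by (intro exI[of _ "{(k, t)}"]) auto
  next
    case top
    then show ?case by (intro exI[of _ "{}"]) auto
  next
    case (min \<phi> \<psi>)
    obtain S where S: "finite S" "\<forall>(k, s)\<in>S. s < b k" "\<forall>p. (\<forall>(k, s)\<in>S. s < p k) \<longrightarrow> t < \<phi> p"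
      using min.IH(1)[of t] min.prems by auto
    obtain T where T: "finite T" "\<forall>(k, s)\<in>T. s < b k" "\<forall>p. (\<forall>(k, s)\<in>T. s < p k) \<longrightarrow> t < \<psi> p"
      using min.IH(2)[of t] min.prems by auto
    show ?case by (rule exI[of _ "S \<union> T"]) (use S T in \<open>simp add: ball_Un\<close>)
  next
    case (ominus \<phi> c)
    then show ?case by (simp add: less_ominus_iff)
  qed
  have "\<phi> b \<le> 0" if gen: "generated \<phi>" and zero: "\<forall>a\<in>A. \<phi> a = 0" for \<phi>
  proof (rule ccontr)
    assume "\<not> \<phi> b \<le> 0"
    then have "0 < \<phi> b" by (simp only: not_le)
    from nbhd[OF gen this] obtain S where S: "finite S" "\<forall>(k, s)\<in>S. s < b k"
      "\<forall>p. (\<forall>(k, s)\<in>S. s < p k) \<longrightarrow> 0 < \<phi> p"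
      by (elim exE conjE)
    from assms[OF S(1,2)] obtain p where "p \<in> A" "\<forall>(k, s)\<in>S. s < p k" ..
    then show False using S(3) zero by force
  qed
  then have "power_dist b A \<le> 0" unfolding power_dist_def by (intro SUP_least) blast
  then show ?thesis by simp
qed

text \<open>
  Finite sets of pairs \<open>(k, s)\<close> with \<open>s < p k\<close> index the canonical points way below \<open>p\<close>;
  coordinates outside the support are \<open>Sup {} = 0\<close>.
\<close>

definition approximants :: "('k \<Rightarrow> ennreal) \<Rightarrow> ('k \<times> ennreal) set set" where
  "approximants p = {S. finite S \<and> (\<forall>(k, s)\<in>S. s < p k)}"

definition step :: "('k \<times> ennreal) set \<Rightarrow> 'k \<Rightarrow> ennreal" where
  "step S k = Sup (S `` {k})"

lemma step_le_iff: "step S k \<le> c \<longleftrightarrow> (\<forall>s. (k, s) \<in> S \<longrightarrow> s \<le> c)"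
  by (auto simp: step_def Sup_le_iff)

lemma step_mono: "S \<subseteq> T \<Longrightarrow> step S k \<le> step T k"
  unfolding step_def by (intro Sup_subset_mono) auto

lemma step_le: "S \<in> approximants p \<Longrightarrow> step S k \<le> p k"
  by (auto simp: step_le_iff approximants_def intro: less_imp_le)

text \<open>A nonempty finite supremum is attained, at a value strictly below \<open>p k\<close>; so
  it is finite even where \<open>p k\<close> is \<infinity>.\<close>

lemma step_finite:
  assumes "S \<in> approximants p"
  shows "step S k < top"
proof (cases "S `` {k} = {}")
  case False
  have "finite (S `` {k})" using assms by (auto simp: approximants_def)
  then have "step S k \<in> S `` {k}"
    using False Max_in[of "S `` {k}"] by (simp add: step_def Max_Sup)
  then have "step S k < p k" using assms by (auto simp: approximants_def)
  then show ?thesis by (rule less_le_trans) simp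
qed (simp add: step_def bot_ennreal)

lemma directed_approximants: "directed_preorder (approximants p) (\<subseteq>)"
  unfolding directed_preorder_def
proof (intro conjI ballI)
  have "{} \<in> approximants p" by (simp add: approximants_def)
  then show "approximants p \<noteq> {}" by blast
next
  fix S T assume "S \<in> approximants p" "T \<in> approximants p"
  then have "S \<union> T \<in> approximants p" by (auto simp: approximants_def)
  then show "\<exists>U\<in>approximants p. S \<subseteq> U \<and> T \<subseteq> U" by blast
qed auto

lemma power_dist_approximants: "power_dist p (step ` approximants p) = 0"
proof (rule power_dist_eq_0)
  fix S assume S: "finite S" "\<forall>(k, s)\<in>S. s < p k"
  \<comment> \<open>Raising each \<open>s\<close> to a value strictly between \<open>s\<close> and
    \<open>p k\<close> gives an approximant whose step exceeds every \<open>s\<close>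
    strictly.\<close>
  then have "\<forall>a\<in>S. \<exists>u. snd a < u \<and> u < p (fst a)" using dense by fastforce
  then obtain f where f: "\<And>a. a \<in> S \<Longrightarrow> snd a < f a \<and> f a < p (fst a)" by metis
  let ?T = "(\<lambda>a. (fst a, f a)) ` S"
  have "?T \<in> approximants p" using S f by (auto simp: approximants_def)
  moreover have "s < step ?T k" if "(k, s) \<in> S" for k s
  proof -
    have "s < f (k, s)" using f[OF that] by simp
    also have "\<dots> \<le> step ?T k" unfolding step_def using that by (intro Sup_upper) force
    finally show ?thesis .
  qed
  ultimately show "\<exists>a\<in>step ` approximants p. \<forall>(k, s)\<in>S. s < a k" by blast
qed


text \<open>Supplies the test function of \<open>scott_weight_le_dist\<close>; the empty infimum is
  the generated constant \<infinity>.\<close>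

lemma generated_INF_ominus: "finite K \<Longrightarrow> generated (\<lambda>p. INF k\<in>K. ominus (p k) (c k))"
proof (induction rule: finite_induct)
  case empty
  then show ?case using generated.top by (simp add: infinity_ennreal_def)
next
  case (insert k K)
  have "generated (\<lambda>p. min (ominus (p k) (c k)) (INF k\<in>K. ominus (p k) (c k)))"
    by (intro generated.min generated.ominus generated.proj insert.IH)
  then show ?case by (simp add: inf_min)
qed

section \<open>Retracts of powers of \<open>[0,\<infinity>]\<close>\<close>

lemma gen_metric_space_Omega:
  assumes "approach_space X \<delta>"
  shows "gen_metric_space X (Omega \<delta>)"
  unfolding gen_metric_space_def Omega_def
proof (intro conjI ballI)
  fix x y z assume "x \<in> X" "y \<in> X" "z \<in> X"
  then show "\<delta> x {z} \<le> \<delta> x {y} + \<delta> y {z}"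
    using approach_spaceD(4)[OF assms, of x "{z}" "{y}"] by simp
qed (use approach_spaceD(1)[OF assms] in simp)

text \<open>Regular coordinates make \<open>q\<close> a contraction into the power
  (\<open>power_dist_le\<close>), so \<open>X\<close> is a retract of the power among approach
  spaces.\<close>

locale power_retract =
  fixes X :: "'a set" and \<delta> :: "'a \<Rightarrow> 'a set \<Rightarrow> ennreal"
    and q :: "'a \<Rightarrow> 'k \<Rightarrow> ennreal" and r :: "('k \<Rightarrow> ennreal) \<Rightarrow> 'a"
  assumes approach: "approach_space X \<delta>" and T0: "T0_approach X \<delta>"
    and q_regular: "\<And>k. regular X \<delta> (\<lambda>x. q x k)"
    and r_contraction: "contraction UNIV power_dist X \<delta> r"
    and r_q: "\<And>x. x \<in> X \<Longrightarrow> r (q x) = x"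
begin

abbreviation "d \<equiv> Omega \<delta>"

lemma met: "gen_metric_space X d"
  by (rule gen_metric_space_Omega[OF approach])

lemma dist_triangle: "x \<in> X \<Longrightarrow> y \<in> X \<Longrightarrow> z \<in> X \<Longrightarrow> d x z \<le> d x y + d y z"
  using met by (simp add: gen_metric_space_def)

lemma separated: "separated X d"
  using T0 by (simp add: separated_def T0_approach_def Omega_def)

lemma r_in: "r p \<in> X"
  using r_contraction by (auto simp: contraction_def)

lemma r_dist_le: "\<delta> (r p) (r ` A) \<le> power_dist p A"
  using r_contraction by (simp add: contraction_def)

lemma r_nonexpansive: "(\<And>k. p k \<le> p' k + c) \<Longrightarrow> d (r p) (r p') \<le> c"
  using r_dist_le[of p "{p'}"] power_dist_singleton_le[of p p' c] by (simp add: Omega_def)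

lemma regular_imp_weight: "regular X \<delta> f \<Longrightarrow> weight X d f"
  unfolding weight_def
proof (intro ballI)
  fix x y assume "regular X \<delta> f" "x \<in> X" "y \<in> X"
  then show "f x \<le> f y + d x y"
    using regularD[of X \<delta> f x "{y}"] by (simp add: Omega_def add.commute)
qed

lemma q_nonexpansive: "x \<in> X \<Longrightarrow> y \<in> X \<Longrightarrow> q x k \<le> q y k + d x y"
  using regular_imp_weight[OF q_regular] by (simp add: weight_def)

section \<open>Colimits in the retract\<close>

text \<open>\<open>?b\<close> is the least point of the power with
  \<open>q z k \<le> ?b k + \<phi> z\<close> for all \<open>z\<close> and \<open>k\<close>. That
  bound gives one inequality after applying \<open>r\<close>; leastness against
  \<open>q y k + ?W\<close> gives the other.\<close>

lemma is_colimit_r: "is_colimit X d \<phi> (r (\<lambda>k. weight_dist X \<phi> (\<lambda>x. q x k)))"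
  unfolding is_colimit_def weight_dist_yoneda
proof (intro conjI ballI antisym)
  let ?b = "\<lambda>k. weight_dist X \<phi> (\<lambda>x. q x k)"
  show "r ?b \<in> X" by (rule r_in)
  fix y assume y: "y \<in> X"
  let ?W = "weight_dist X \<phi> (\<lambda>z. d z y)"
  show "?W \<le> d (r ?b) y"
    unfolding weight_dist_le_iff
  proof
    fix z assume z: "z \<in> X"
    have "q z k \<le> ?b k + \<phi> z" for k
      using weight_dist_le_iff[of X \<phi> "\<lambda>x. q x k" "?b k"] z by simp
    then have "d (r (q z)) (r ?b) \<le> \<phi> z" by (rule r_nonexpansive)
    then have "d z (r ?b) \<le> \<phi> z" using z by (simp add: r_q)
    then have "d z (r ?b) + d (r ?b) y \<le> \<phi> z + d (r ?b) y" by (rule add_right_mono)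
    then show "d z y \<le> d (r ?b) y + \<phi> z"
      using dist_triangle[OF z r_in y] by (metis add.commute order_trans)
  qed
  have "?b k \<le> q y k + ?W" for k
    unfolding weight_dist_le_iff[of X \<phi> "\<lambda>x. q x k"]
  proof
    fix x assume x: "x \<in> X"
    have "q x k \<le> q y k + d x y" by (rule q_nonexpansive[OF x y])
    also have "d x y \<le> ?W + \<phi> x"
      using weight_dist_le_iff[of X \<phi> "\<lambda>z. d z y" ?W] x by simp
    finally show "q x k \<le> q y k + ?W + \<phi> x" by (simp add: add.assoc add_left_mono)
  qed
  then have "d (r ?b) (r (q y)) \<le> ?W" by (rule r_nonexpansive)
  then show "d (r ?b) y \<le> ?W" using y by (simp add: r_q)
qed

lemma cocomplete: "cocomplete X d"
  unfolding cocomplete_def using is_colimit_r by blast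

lemma is_colimit_colim: "is_colimit X d \<phi> (colim X d \<phi>)"
  unfolding colim_def using is_colimit_r by (rule someI)

lemma colim_eqI: "is_colimit X d \<phi> a \<Longrightarrow> colim X d \<phi> = a"
  by (rule is_colimit_unique[OF met separated is_colimit_colim])

text \<open>The defining equation of the colimit is tested at the colimit itself, where its right
  side is 0.\<close>

lemma dist_colim_le:
  assumes "y \<in> X"
  shows "d y (colim X d \<phi>) \<le> \<phi> y"
proof -
  let ?a = "colim X d \<phi>"
  have "?a \<in> X" "weight_dist X \<phi> (\<lambda>z. d z ?a) = d ?a ?a"
    using is_colimit_colim[of \<phi>] unfolding is_colimit_def weight_dist_yoneda by auto
  then have "weight_dist X \<phi> (\<lambda>z. d z ?a) \<le> 0" using met by (simp add: gen_metric_space_def)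
  then show ?thesis using assms unfolding weight_dist_le_iff by simp
qed

text \<open>Directedness puts images of points of weight at most \<open>e\<close> into every basic
  neighbourhood of \<open>?b\<close>. Applying \<open>r\<close> yields
  \<open>\<delta> a A = 0\<close>, so regularity bounds \<open>f a\<close> by the supremum of
  \<open>f\<close> on \<open>A\<close>.\<close>

lemma regular_flat_colimit:
  assumes flat: "flat X d \<phi>" and a: "is_colimit X d \<phi> a" and f: "regular X \<delta> f"
  shows "f a \<le> weight_dist X \<phi> f"
proof (rule ennreal_le_epsilon)
  fix e :: real assume "0 < e"
  let ?b = "\<lambda>k. weight_dist X \<phi> (\<lambda>x. q x k)"
  define A where "A = {z\<in>X. \<phi> z \<le> ennreal e}"
  have AX: "A \<subseteq> X" by (auto simp: A_def)
  have ab: "a = r ?b" by (rule is_colimit_unique[OF met separated a is_colimit_r])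
  have "power_dist ?b (q ` A) = 0"
  proof (rule power_dist_eq_0)
    fix S assume S: "finite S" "\<forall>(k, s)\<in>S. s < ?b k"
    \<comment> \<open>Each strict bound below the supremum \<open>?b\<close> is beaten at some
      \<open>y\<close> with positive slack \<open>\<eta>\<close>.\<close>
    have "\<exists>y\<in>X. \<exists>\<eta>>0. snd p + \<phi> y + \<eta> < q y (fst p)" if "p \<in> S" for p
    proof -
      have "snd p < ?b (fst p)" using S(2) that by auto
      then obtain y where y: "y \<in> X" "snd p + \<phi> y < q y (fst p)"
        unfolding weight_dist_def less_SUP_iff less_ominus_iff by blast
      then obtain m where m: "snd p + \<phi> y < m" "m < q y (fst p)" using dense by blast
      then have "0 < m - (snd p + \<phi> y)" "snd p + \<phi> y + (m - (snd p + \<phi> y)) = m"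
        by (auto simp: diff_gr0_ennreal add_diff_inverse_ennreal order_less_le_trans)
      then show ?thesis using y(1) m(2) by metis
    qed
    then obtain h \<eta> where h: "\<And>p. p \<in> S \<Longrightarrow> h p \<in> X"
      and \<eta>: "\<And>p. p \<in> S \<Longrightarrow> 0 < \<eta> p"
      and h\<eta>: "\<And>p. p \<in> S \<Longrightarrow> snd p + \<phi> (h p) + \<eta> p < q (h p) (fst p)"
      by metis
    \<comment> \<open>The tolerance fits under all slacks, and under \<open>e\<close> so that the
      point found lies in \<open>A\<close>.\<close>
    define \<epsilon> where "\<epsilon> = Min (insert (ennreal e) (\<eta> ` S))"
    have "0 < \<epsilon>" using \<open>0 < e\<close> \<eta> S(1) by (simp add: \<epsilon>_def)
    have \<epsilon>_le: "\<epsilon> \<le> ennreal e" "\<And>p. p \<in> S \<Longrightarrow> \<epsilon> \<le> \<eta> p"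
      using S(1) by (simp_all add: \<epsilon>_def)
    obtain z where z: "z \<in> X" "\<phi> z < \<epsilon>" "\<And>y. y \<in> h ` S \<Longrightarrow> d y z \<le> \<phi> y + \<epsilon>"
      using flat_directed[OF met flat _ _ \<open>0 < \<epsilon>\<close>, of "h ` S"] S(1) h by blast
    have "snd p < q z (fst p)" if p: "p \<in> S" for p
    proof (rule ccontr)
      assume "\<not> snd p < q z (fst p)"
      then have le: "q z (fst p) \<le> snd p" by simp
      \<comment> \<open>Passing from \<open>h p\<close> to \<open>z\<close> costs at most
        \<open>\<phi> (h p) + \<eta> p\<close>, which the slack at \<open>h p\<close>
        covers.\<close>
      have "q (h p) (fst p) \<le> q z (fst p) + d (h p) z" by (rule q_nonexpansive[OF h[OF p] z(1)])
      also have "\<dots> \<le> snd p + (\<phi> (h p) + \<eta> p)"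
        using z(3)[of "h p"] p \<epsilon>_le(2)[OF p] le
        by (intro add_mono) (auto intro: order_trans add_left_mono)
      finally show False using h\<eta>[OF p] by (simp add: add.assoc)
    qed
    moreover have "z \<in> A" using z \<epsilon>_le(1) by (auto simp: A_def)
    ultimately show "\<exists>p\<in>q ` A. \<forall>(k, s)\<in>S. s < p k" by fastforce
  qed
  moreover have "r ` q ` A = A" using AX r_q by (force simp: image_image)
  ultimately have "\<delta> a A = 0" using r_dist_le[of ?b "q ` A"] ab by simp
  then have "f a \<le> (SUP z\<in>A. f z)"
    using regularD[OF f _ AX, of a] r_in ab by simp
  also have "\<dots> \<le> weight_dist X \<phi> f + ennreal e"
  proof (rule SUP_least)
    fix z assume "z \<in> A"
    then have "f z \<le> weight_dist X \<phi> f + \<phi> z" "\<phi> z \<le> ennreal e"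
      using weight_dist_le_iff[of X \<phi> f "weight_dist X \<phi> f"] by (auto simp: A_def)
    then show "f z \<le> weight_dist X \<phi> f + ennreal e"
      by (meson add_left_mono order_trans)
  qed
  finally show "f a \<le> weight_dist X \<phi> f + ennreal e" .
qed

text \<open>A Yoneda limit is a colimit of the weight of its net, which is flat, so
  \<open>regular_flat_colimit\<close> applies.\<close>

lemma regular_imp_scott_weight:
  assumes f: "regular X \<delta> f"
  shows "scott_weight X d f"
  unfolding scott_weight_def
proof (intro conjI allI impI regular_imp_weight[OF f], elim conjE)
  fix I :: "'a net_index set" and le x a
  assume net: "net_in X I le x" "forward_cauchy d I le x" and a: "yoneda_limit X d I le x a"
  have "f a \<le> weight_dist X (net_weight d I le x) f"
    by (rule regular_flat_colimit[OF flat_net_weight[OF met net] _ f])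
      (use a is_colimit_net_weight[OF met net] in simp)
  then show "f a \<le> inf_sup I le (\<lambda>j. f (x j))"
    by (simp add: inf_sup_weight[OF net regular_imp_weight[OF f]])
qed

section \<open>The canonical net converging to a point\<close>

abbreviation "approximant S \<equiv> r (step S)"

lemma approximant_dist: "S \<subseteq> T \<Longrightarrow> d (approximant S) (approximant T) = 0"
  using r_nonexpansive[of "step S" "step T" 0] step_mono[of S T] by simp

lemma weight_approximant_mono:
  assumes "weight X d \<phi>" "S \<subseteq> T"
  shows "\<phi> (approximant S) \<le> \<phi> (approximant T)"
  using assms r_in approximant_dist[OF assms(2)] unfolding weight_def by (metis add.right_neutral)

lemma inf_sup_approximant:
  assumes "weight X d \<phi>"
  shows "inf_sup (approximants p) (\<subseteq>) (\<lambda>S. \<phi> (approximant S))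
    = (SUP S\<in>approximants p. \<phi> (approximant S))"
  by (rule inf_sup_increasing[OF directed_approximants weight_approximant_mono[OF assms]])

lemma net_approximant: "net_in X (approximants p) (\<subseteq>) approximant"
  by (simp add: net_in_def directed_approximants r_in)

lemma forward_cauchy_approximant: "forward_cauchy d (approximants p) (\<subseteq>) approximant"
proof -
  let ?I = "approximants p"
  \<comment> \<open>Every tail works, since distances along inclusions vanish; \<open>{}\<close>
    serves as its start.\<close>
  have "{} \<in> ?I" by (simp add: approximants_def)
  then have "(INF i\<in>?I. SUP (j, k)\<in>{(j, k). j \<in> ?I \<and> k \<in> ?I \<and> i \<subseteq> j \<and> j \<subseteq> k}.
      d (approximant j) (approximant k)) \<le> 0"
    by (rule INF_lower2, intro SUP_least) (auto simp: approximant_dist)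
  then show ?thesis by (simp add: forward_cauchy_def)
qed

text \<open>The \<open>inf_sup\<close> is a supremum by monotonicity. It is at least
  \<open>d x y\<close> because \<open>r\<close> carries the closure statement
  \<open>power_dist_approximants\<close> to \<open>x\<close>, and at most \<open>d x y\<close>
  because each approximant has distance 0 to \<open>x\<close>.\<close>

lemma yoneda_limit_approximant:
  assumes x: "x \<in> X"
  shows "yoneda_limit X d (approximants (q x)) (\<subseteq>) approximant x"
  unfolding yoneda_limit_def
proof (intro conjI ballI x)
  fix y assume y: "y \<in> X"
  let ?A = "r ` step ` approximants (q x)"
  have "d x y = (SUP S\<in>approximants (q x). d (approximant S) y)"
  proof (rule antisym)
    have "\<delta> x ?A = 0"
      using r_dist_le[of "q x" "step ` approximants (q x)"] x
      by (simp add: r_q power_dist_approximants)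
    then have "\<delta> x {y} \<le> (SUP z\<in>?A. \<delta> z {y})"
      using approach_spaceD(4)[OF approach x, of "{y}" ?A] r_in y by (simp add: image_subset_iff)
    then show "d x y \<le> (SUP S\<in>approximants (q x). d (approximant S) y)"
      by (simp add: Omega_def image_image)
    show "(SUP S\<in>approximants (q x). d (approximant S) y) \<le> d x y"
    proof (rule SUP_least)
      fix S assume "S \<in> approximants (q x)"
      then have "d (approximant S) (r (q x)) \<le> 0" by (intro r_nonexpansive) (simp add: step_le)
      then show "d (approximant S) y \<le> d x y"
        using dist_triangle[OF r_in x y, of "step S"] x by (simp add: r_q)
    qed
  qed
  then show "d x y = inf_sup (approximants (q x)) (\<subseteq>) (\<lambda>S. d (approximant S) y)"
    by (simp add: inf_sup_approximant[OF dist_weight[OF met y]])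
qed

section \<open>The Scott distance\<close>

text \<open>For \<open>t < \<phi> x\<close>, some approximant has weight above \<open>t\<close>, so
  its distance to each point of \<open>A\<close> exceeds \<open>t\<close>. This is visible in a
  coordinate, which yields a generated function that vanishes on the image of \<open>A\<close> and
  is at least \<open>t\<close> at \<open>q x\<close>.\<close>

lemma scott_weight_le_dist:
  assumes \<phi>: "scott_weight X d \<phi>" and zero: "\<forall>a\<in>A. \<phi> a = 0" and A: "A \<subseteq> X" and x: "x \<in> X"
  shows "\<phi> x \<le> \<delta> x A"
proof (rule dense_le)
  fix t assume "t < \<phi> x"
  have weight: "weight X d \<phi>" using \<phi> by (simp add: scott_weight_def)
  \<comment> \<open>This net is indexed by finite sets of pairs, so the Scott property is used for
    an arbitrary index type.\<close>
  have "\<phi> x \<le> inf_sup (approximants (q x)) (\<subseteq>) (\<lambda>S. \<phi> (approximant S))"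
    by (rule scott_weight_any_index[OF met \<phi> net_approximant forward_cauchy_approximant
        yoneda_limit_approximant[OF x]])
  with \<open>t < \<phi> x\<close> have "t < (SUP S\<in>approximants (q x). \<phi> (approximant S))"
    unfolding inf_sup_approximant[OF weight] by (rule less_le_trans)
  then obtain S where S: "S \<in> approximants (q x)" "t < \<phi> (approximant S)"
    unfolding less_SUP_iff by blast
  define K where "K = {k \<in> fst ` S. t < step S k}"
  \<comment> \<open>With threshold \<open>step S k - t\<close>, \<open>g\<close> is 0 once one
    coordinate in \<open>K\<close> lies at least \<open>t\<close> below \<open>step S\<close>, and
    at least \<open>t\<close> where all of them reach \<open>step S\<close>.\<close>
  define g where "g p = (INF k\<in>K. ominus (p k) (step S k - t))" for p
  have "finite K" using S(1) by (simp add: K_def approximants_def)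
  then have "generated g" unfolding g_def by (rule generated_INF_ominus)
  moreover have "g (q a) = 0" if a: "a \<in> A" for a
  proof -
    have aX: "a \<in> X" using a A by auto
    have "\<not> (\<forall>k. step S k \<le> q a k + t)"
    proof
      assume "\<forall>k. step S k \<le> q a k + t"
      then have "d (approximant S) a \<le> t"
        using r_nonexpansive[of "step S" "q a" t] aX by (simp add: r_q)
      then have "\<phi> (approximant S) \<le> t"
        using weight zero a aX r_in unfolding weight_def by (metis add_0 order_trans)
      then show False using S(2) by simp
    qed
    then obtain k where k: "q a k + t < step S k" by (auto simp: not_le)
    have "k \<in> fst ` S"
    proof (rule ccontr)
      \<comment> \<open>Outside the support \<open>step S k\<close> is 0, which nothing is strictly
        below.\<close>
      assume "k \<notin> fst ` S"
      then have "step S k \<le> 0" unfolding step_le_iff by force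
      then show False using k by simp
    qed
    moreover have "t < step S k" by (rule le_less_trans[OF _ k]) simp
    ultimately have "k \<in> K" by (simp add: K_def)
    moreover have "q a k \<le> step S k - t"
      using k by (simp add: ennreal_le_minus_iff less_imp_le)
    ultimately have "g (q a) \<le> 0"
      unfolding g_def by (intro INF_lower2[of k]) (auto simp: ominus_def)
    then show ?thesis by simp
  qed
  ultimately have "g (q x) \<le> power_dist (q x) (q ` A)"
    unfolding power_dist_def by (intro SUP_upper) auto
  also have "\<dots> \<le> \<delta> x A" by (rule power_dist_le[OF approach q_regular x A])
  finally have "g (q x) \<le> \<delta> x A" .
  moreover have "t \<le> g (q x)"
    unfolding g_def
  proof (rule INF_greatest, rule ccontr)
    fix k assume "k \<in> K"
    then have tk: "t < step S k" by (simp add: K_def)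
    let ?b = "step S k - t"
    assume "\<not> t \<le> ominus (q x k) ?b"
    \<comment> \<open>Adding \<open>?b\<close> keeps the inequality strict because
      \<open>step_finite\<close> makes \<open>?b\<close> finite.\<close>
    then have "ominus (q x k) ?b + ?b < t + ?b"
      using step_finite[OF S(1), of k]
      by (simp add: not_le ennreal_add_left_cancel_less add.commute[of _ ?b])
    also have "t + ?b = step S k" using tk by (simp add: add_diff_inverse_ennreal)
    also have "step S k \<le> q x k" by (rule step_le[OF S(1)])
    finally show False using le_add_ominus[of "q x k" ?b] by simp
  qed
  ultimately show "t \<le> \<delta> x A" by simp
qed

text \<open>The distance to \<open>A\<close> is regular, hence itself one of the Scott weights
  vanishing on \<open>A\<close>, and by \<open>scott_weight_le_dist\<close> it is the
  largest.\<close>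

lemma Sigma_Omega:
  assumes "x \<in> X" "A \<subseteq> X"
  shows "\<delta> x A = Sigma_dist X d x A"
  unfolding Sigma_dist_def
proof (rule antisym)
  have "scott_weight X d (\<lambda>z. \<delta> z A)" "\<forall>a\<in>A. \<delta> a A = 0"
    using assms regular_imp_scott_weight[OF regular_dist[OF approach]] approach_mem[OF approach]
    by auto
  then show "\<delta> x A \<le> (SUP \<phi>\<in>{\<phi>. scott_weight X d \<phi> \<and> (\<forall>a\<in>A. \<phi> a = 0)}. \<phi> x)"
    by (intro SUP_upper2[of "\<lambda>z. \<delta> z A"]) auto
  show "(SUP \<phi>\<in>{\<phi>. scott_weight X d \<phi> \<and> (\<forall>a\<in>A. \<phi> a = 0)}. \<phi> x) \<le> \<delta> x A"
    by (intro SUP_least) (use scott_weight_le_dist assms in auto)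
qed

section \<open>The left adjoint of \<open>colim\<close>\<close>

text \<open>Each of the finitely many bounds in \<open>S\<close> is met, up to \<open>?c\<close>, by
  some \<open>q y k\<close> less \<open>\<phi> y\<close>. Directedness replaces these
  \<open>y\<close> by one \<open>z\<close> of small weight, and then the approximant is within
  \<open>?c\<close> plus a small error of \<open>z\<close>.\<close>

lemma flat_approximant_le:
  assumes flat: "flat X d \<phi>" and x: "x \<in> X" and S: "S \<in> approximants (q x)"
  shows "\<phi> (approximant S) \<le> d x (colim X d \<phi>)"
proof (cases "d x (colim X d \<phi>) = top")
  case False
  let ?a = "colim X d \<phi>"
  let ?c = "d x ?a"
  have aX: "?a \<in> X" using is_colimit_colim[of \<phi>] by (simp add: is_colimit_def)
  have ne: "X \<noteq> {}" using x by auto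
  have "\<exists>y\<in>X. snd p \<le> ?c + ominus (q y (fst p)) (\<phi> y)" if "p \<in> S" for p
  proof -
    \<comment> \<open>Regularity of the coordinate at the colimit turns the bound into one below a
      supremum over \<open>X\<close>, hence one met at a point.\<close>
    have "snd p < q x (fst p)" using S that by (auto simp: approximants_def)
    also have "\<dots> \<le> q ?a (fst p) + ?c" by (rule q_nonexpansive[OF x aX])
    also have "q ?a (fst p) \<le> weight_dist X \<phi> (\<lambda>z. q z (fst p))"
      by (rule regular_flat_colimit[OF flat is_colimit_colim q_regular])
    finally have "snd p < weight_dist X \<phi> (\<lambda>z. q z (fst p)) + ?c"
      by (simp add: add_right_mono)
    then have "snd p < (SUP y\<in>X. ominus (q y (fst p)) (\<phi> y) + ?c)"
      by (simp add: weight_dist_def ennreal_SUP_add_left[OF ne])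
    then show ?thesis unfolding less_SUP_iff by (metis add.commute less_imp_le)
  qed
  then obtain h where h: "\<And>p. p \<in> S \<Longrightarrow> h p \<in> X"
    "\<And>p. p \<in> S \<Longrightarrow> snd p \<le> ?c + ominus (q (h p) (fst p)) (\<phi> (h p))"
    by metis
  show ?thesis
  proof (rule ennreal_le_epsilon)
    fix e :: real assume e: "0 < e"
    let ?e = "ennreal (e / 2)"
    have "finite (h ` S)" "h ` S \<subseteq> X" using S h(1) by (auto simp: approximants_def)
    then obtain z where z: "z \<in> X" "\<phi> z < ?e" "\<And>y. y \<in> h ` S \<Longrightarrow> d y z \<le> \<phi> y + ?e"
      using flat_directed[OF met flat, of "h ` S" ?e] e by auto
    have "s \<le> q z k + (?c + ?e)" if p: "(k, s) \<in> S" for k s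
    proof -
      let ?y = "h (k, s)"
      have "q ?y k \<le> q z k + d ?y z" by (rule q_nonexpansive[OF h(1)[OF p] z(1)])
      also have "d ?y z \<le> \<phi> ?y + ?e" using z(3) p by blast
      finally have "q ?y k \<le> q z k + ?e + \<phi> ?y" by (simp add: ac_simps add_left_mono)
      then have "ominus (q ?y k) (\<phi> ?y) \<le> q z k + ?e" by (rule ominus_le)
      then have "?c + ominus (q ?y k) (\<phi> ?y) \<le> ?c + (q z k + ?e)" by (rule add_left_mono)
      also have "\<dots> = q z k + (?c + ?e)" by (simp only: ac_simps)
      finally show ?thesis using h(2)[OF p, unfolded fst_conv snd_conv] by (rule order_trans[rotated])
    qed
    then have "step S k \<le> q z k + (?c + ?e)" for k by (simp add: step_le_iff)
    then have "d (approximant S) (r (q z)) \<le> ?c + ?e" by (rule r_nonexpansive)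
    then have dz: "d (approximant S) z \<le> ?c + ?e" using z(1) by (simp add: r_q)
    have "\<phi> (approximant S) \<le> \<phi> z + d (approximant S) z"
      using flat z(1) r_in by (simp add: flat_def weight_def)
    also have "\<dots> \<le> ?e + (?c + ?e)" using z(2) dz by (intro add_mono) simp_all
    also have "\<dots> = ?c + (?e + ?e)" by (simp add: ac_simps)
    also have "?e + ?e = ennreal e" using e by (simp flip: ennreal_plus)
    finally show "\<phi> (approximant S) \<le> ?c + ennreal e" .
  qed
qed simp

text \<open>\<open>restrict\<close> picks the extensional representative demanded by
  \<open>flat_weights\<close>.\<close>

definition way_below :: "'a \<Rightarrow> 'a \<Rightarrow> ennreal" where
  "way_below x = restrict (net_weight d (approximants (q x)) (\<subseteq>) approximant) X"

lemma way_below_flat: "way_below x \<in> flat_weights X d"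
proof -
  have "flat X d (way_below x)"
    unfolding way_below_def
    by (intro flat_restrict flat_net_weight met net_approximant forward_cauchy_approximant)
  moreover have "way_below x \<in> extensional X" by (simp add: way_below_def)
  ultimately show ?thesis by (simp add: flat_weights_def weights_def flat_def)
qed

lemma colim_way_below:
  assumes "x \<in> X"
  shows "colim X d (way_below x) = x"
proof (rule colim_eqI)
  have "is_colimit X d (net_weight d (approximants (q x)) (\<subseteq>) approximant) x"
    using yoneda_limit_approximant[OF assms]
      is_colimit_net_weight[OF met net_approximant forward_cauchy_approximant] by simp
  then show "is_colimit X d (way_below x) x"
    using is_colimit_cong[of X "way_below x"] by (simp add: way_below_def)
qed

text \<open>The distance is the supremum of \<open>\<phi>\<close> over the approximants.
  \<open>flat_approximant_le\<close> bounds it above; \<open>dist_colim_le\<close> at each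
  approximant bounds it below, as \<open>x\<close> is their limit.\<close>

lemma way_below_adjoint:
  assumes x: "x \<in> X" and \<phi>: "\<phi> \<in> flat_weights X d"
  shows "weight_dist X (way_below x) \<phi> = d x (colim X d \<phi>)"
proof -
  let ?a = "colim X d \<phi>"
  have flat: "flat X d \<phi>" and weight: "weight X d \<phi>"
    using \<phi> by (auto simp: flat_weights_def flat_def)
  have aX: "?a \<in> X" using is_colimit_colim[of \<phi>] by (simp add: is_colimit_def)
  have "weight_dist X (way_below x) \<phi>
      = weight_dist X (net_weight d (approximants (q x)) (\<subseteq>) approximant) \<phi>"
    by (rule weight_dist_cong) (simp_all add: way_below_def)
  also have "\<dots> = (SUP S\<in>approximants (q x). \<phi> (approximant S))"
    using inf_sup_weight[OF net_approximant forward_cauchy_approximant weight]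
      inf_sup_approximant[OF weight] by simp
  also have "\<dots> = d x ?a"
  proof (rule antisym)
    show "(SUP S\<in>approximants (q x). \<phi> (approximant S)) \<le> d x ?a"
      by (intro SUP_least flat_approximant_le flat x)
    have "d x ?a = (SUP S\<in>approximants (q x). d (approximant S) ?a)"
      using yoneda_limit_approximant[OF x] aX inf_sup_approximant[OF dist_weight[OF met aX]]
      by (simp add: yoneda_limit_def)
    also have "\<dots> \<le> (SUP S\<in>approximants (q x). \<phi> (approximant S))"
      by (intro SUP_mono' dist_colim_le r_in)
    finally show "d x ?a \<le> (SUP S\<in>approximants (q x). \<phi> (approximant S))" .
  qed
  finally show ?thesis .
qed

text \<open>The weight represented by the colimit of \<open>\<psi>\<close> lies below
  \<open>\<psi>\<close>, so \<open>\<phi>\<close> is no farther from it than from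
  \<open>\<psi>\<close>.\<close>

lemma colim_non_expansive: "d (colim X d \<phi>) (colim X d \<psi>) \<le> weight_dist X \<phi> \<psi>"
proof -
  let ?b = "colim X d \<psi>"
  have bX: "?b \<in> X" using is_colimit_colim[of \<psi>] by (simp add: is_colimit_def)
  have "d (colim X d \<phi>) ?b = weight_dist X \<phi> (\<lambda>z. d z ?b)"
    using is_colimit_colim[of \<phi>] bX by (simp add: is_colimit_def weight_dist_yoneda)
  also have "\<dots> \<le> weight_dist X \<phi> \<psi>"
    unfolding weight_dist_le_iff
  proof
    fix z assume z: "z \<in> X"
    have "d z ?b \<le> \<psi> z" by (rule dist_colim_le[OF z])
    also have "\<dots> \<le> weight_dist X \<phi> \<psi> + \<phi> z"
      using weight_dist_le_iff[of X \<phi> \<psi> "weight_dist X \<phi> \<psi>"] z by simp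
    finally show "d z ?b \<le> weight_dist X \<phi> \<psi> + \<phi> z" .
  qed
  finally show ?thesis .
qed

lemma continuous: "continuous_space X d"
  unfolding continuous_space_def
proof (intro conjI exI)
  show "yoneda_complete X d" by (rule cocomplete_imp_yoneda_complete[OF met cocomplete])
  show "left_adjoint X d (flat_weights X d) (weight_dist X) way_below (colim X d)"
    \<comment> \<open>By adjointness the distance from \<open>way_below x\<close> to
      \<open>way_below y\<close> is \<open>d x (colim X d (way_below y))\<close>, which is
      \<open>d x y\<close>; so \<open>way_below\<close> is non-expansive.\<close>
    unfolding left_adjoint_def non_expansive_def
    using way_below_flat way_below_adjoint colim_way_below colim_non_expansive
      is_colimit_colim by (auto simp: is_colimit_def)
qed

end

section \<open>From injectivity to a retraction\<close>

lemma injective_approach_retract: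
  assumes inj: "injective_approach X \<delta>"
  obtains q :: "'a \<Rightarrow> 'a set \<Rightarrow> ennreal" and r where "power_retract X \<delta> q r"
proof -
  have X: "approach_space X \<delta>" and T0: "T0_approach X \<delta>"
    using inj by (simp_all add: injective_approach_def)
  \<comment> \<open>Intersecting with \<open>X\<close> makes the coordinate regular for every index
    \<open>A\<close>, also for sets not contained in \<open>X\<close>.\<close>
  define q where "q x = (\<lambda>A. \<delta> x (A \<inter> X))" for x
  have qreg: "regular X \<delta> (\<lambda>x. q x A)" for A
    unfolding q_def by (rule regular_dist[OF X]) auto
  have qd: "power_dist (q x) (q ` A) = \<delta> x A" if "x \<in> X" "A \<subseteq> X" for x A
  proof (rule antisym[OF power_dist_le[OF X qreg that]])
    have "\<delta> x A = q x A" using that by (simp add: q_def Int_absorb2)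
    also have "\<dots> \<le> power_dist (q x) (q ` A)"
      unfolding power_dist_def
      by (rule SUP_upper2[of "\<lambda>p. p A"])
        (use that in \<open>auto intro: generated.proj simp: q_def Int_absorb2 approach_mem[OF X]\<close>)
    finally show "\<delta> x A \<le> power_dist (q x) (q ` A)" .
  qed
  have "approach_embedding X \<delta> UNIV power_dist q"
    using qd by (simp add: approach_embedding_def contraction_def)
  moreover have "contraction X \<delta> X \<delta> (\<lambda>x. x)" by (simp add: contraction_def)
  \<comment> \<open>\<open>r\<close> extends the identity of \<open>X\<close> along
    \<open>q\<close>; source and target of \<open>q\<close> have different types, so injectivity is
    used for arbitrary types.\<close>
  ultimately obtain r where "contraction UNIV power_dist X \<delta> r" "\<forall>x\<in>X. r (q x) = x"
    using injective_approach_any_type[OF inj, unfolded extends_along_embeddings_def] X approach_power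
    by blast
  then have "power_retract X \<delta> q r" using X T0 qreg by unfold_locales auto
  then show thesis by (rule that)
qed

theorem theorem5p11:
  fixes X :: "'a set" and \<delta> :: "'a \<Rightarrow> 'a set \<Rightarrow> ennreal"
  assumes "approach_space X \<delta>" and "T0_approach X \<delta>" and "injective_approach X \<delta>"
  shows "gen_metric_space X (Omega \<delta>) \<and> separated X (Omega \<delta>) \<and>
         cocomplete X (Omega \<delta>) \<and> continuous_space X (Omega \<delta>) \<and>
         (\<forall>x\<in>X. \<forall>A. A \<subseteq> X \<longrightarrow> \<delta> x A = Sigma_dist X (Omega \<delta>) x A)"
proof -
  obtain q :: "'a \<Rightarrow> 'a set \<Rightarrow> ennreal" and r where "power_retract X \<delta> q r"
    using injective_approach_retract[OF assms(3)] .
  then interpret power_retract X \<delta> q r .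
  show ?thesis using met separated cocomplete continuous Sigma_Omega by blast
qed

end
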